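(* Fix a real number $M>2$, let $Q=(0,1)^2$, and let $(X,d_X)$ be the metric space of $BV$ homeomorphisms $f:Q\to Q$ with $f_{|\partial Q}=\mathrm{Id}$ and $Var(f,Q)<M$ defined in the context. Let $$A:=\{f\in X:\ \text{there exists a Borel set } E\subset Q \text{ with } |E|=0 \text{ and } |f(E)|=1\}.$$ Then $A$ is residual in $X$, i.e. $A$ contains the intersection of countably many open dense subsets of $(X,d_X)$.
   Context: $|E|$ denotes the Lebesgue measure of $E\subset\mathbb{R}^2$. On $\mathbb{R}^4$ put $|(a,b,c,d)|_\infty=\max\{|a|,|b|,|c|,|d|\}$. For $f=(f_1,f_2):Q\to Q$, the variation of $f$ in $Q$ is $$Var(f,Q):=\sup\left\{\int_Q (f_1\,\mathrm{div}\,\phi_1+f_2\,\mathrm{div}\,\phi_2)\,dx:\ \phi=(\phi_1,\phi_2)\in C^1_c(Q,\mathbb{R}^2\times\mathbb{R}^2),\ |\phi(x)|_\infty\le 1\ \text{for all } x\in Q\right\},$$ and $f$ is $BV$ if $Var(f,Q)<\infty$. For a homeomorphism $f:Q\to Q$ of the open square, $f_{|\partial Q}=\mathrm{Id}$ means that $f$ extends continuously to $\overline Q$ by the identity on $\partial Q$. Define $$X:=\{f:Q\to Q:\ f \text{ is a } BV \text{ homeomorphism},\ f_{|\partial Q}=\mathrm{Id},\ Var(f,Q)<M\},$$ $$d_X(f,g):=\|f-g\|_\infty+\|f^{-1}-g^{-1}\|_\infty+\left|\frac{1}{M-Var(f,Q)}-\frac{1}{M-Var(g,Q)}\right|,$$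 where $\|\cdot\|_\infty$ is the supremum norm on $Q$. *)

theory Defs
  imports "HOL-Analysis.Analysis"
begin

definition unit_square :: "(real^2) set"
  where "unit_square = box 0 1"

definition divergence :: "(real^'n \<Rightarrow> real^'n) \<Rightarrow> real^'n \<Rightarrow> real"
  where "divergence \<phi> x = (\<Sum>i\<in>UNIV. frechet_derivative \<phi> (at x) (axis i 1) $ i)"

(* C^1_c(U,F) for open U. Functions are total here; their values outside U are irrelevant,
   so the support is the closure of the non-zero points inside U. *)
definition C1_compact_support ::
    "('a::real_normed_vector) set \<Rightarrow> ('a \<Rightarrow> 'b::real_normed_vector) set"
  where "C1_compact_support U =
    {\<phi>. (\<exists>\<phi>' :: 'a \<Rightarrow> 'a \<Rightarrow>\<^sub>L 'b.
            (\<forall>x\<in>U. (\<phi> has_derivative blinfun_apply (\<phi>' x)) (at x)) \<and> continuous_on U \<phi>') \<and>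
         compact (closure {x\<in>U. \<phi> x \<noteq> 0}) \<and> closure {x\<in>U. \<phi> x \<noteq> 0} \<subseteq> U}"

(* On (real^2) \<times> (real^2) the library's infnorm is the maximum of the absolute values of
   the four coordinates. *)
definition Var :: "(real^2 \<Rightarrow> real^2) \<Rightarrow> (real^2) set \<Rightarrow> ereal"
  where "Var f U =
    (SUP \<phi> \<in> {\<phi> :: real^2 \<Rightarrow> (real^2) \<times> (real^2).
                 \<phi> \<in> C1_compact_support U \<and> (\<forall>x\<in>U. infnorm (\<phi> x) \<le> 1)}.
       ereal (LINT x:U|lborel. f x $ 1 * divergence (\<lambda>y. fst (\<phi> y)) x
                             + f x $ 2 * divergence (\<lambda>y. snd (\<phi> y)) x))"

definition BV :: "(real^2 \<Rightarrow> real^2) \<Rightarrow> (real^2) set \<Rightarrow> bool"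
  where "BV f U \<longleftrightarrow> Var f U < \<infinity>"

(* f extends continuously to the closure of U by the identity on the boundary *)
definition identity_on_boundary :: "('a::topological_space \<Rightarrow> 'a) \<Rightarrow> 'a set \<Rightarrow> bool"
  where "identity_on_boundary f U \<longleftrightarrow>
    continuous_on (closure U) (\<lambda>x. if x \<in> U then f x else x)"

(* A map Q -> Q is represented by the function on real^2 which agrees with it on Q and is
   undefined elsewhere (extensional), so that equality in BV_homeos M is equality of maps on Q. *)
definition BV_homeos :: "real \<Rightarrow> (real^2 \<Rightarrow> real^2) set"
  where "BV_homeos M =
    {f \<in> extensional unit_square.
       homeomorphism unit_square unit_square f (inv_into unit_square f) \<and>
       BV f unit_square \<and>
       identity_on_boundary f unit_square \<and>
       Var f unit_square < ereal M}"

definition sup_norm_on :: "'a set \<Rightarrow> ('a \<Rightarrow> 'b::real_normed_vector) \<Rightarrow> real"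
  where "sup_norm_on S h = (SUP x\<in>S. norm (h x))"

(* The value 0 off BV_homeos M is junk: the locale Metric_space requires non-negativity and symmetry
   also for arguments outside the carrier. *)
definition dX :: "real \<Rightarrow> (real^2 \<Rightarrow> real^2) \<Rightarrow> (real^2 \<Rightarrow> real^2) \<Rightarrow> real"
  where "dX M f g =
    (if f \<in> BV_homeos M \<and> g \<in> BV_homeos M then
       sup_norm_on unit_square (\<lambda>x. f x - g x)
       + sup_norm_on unit_square (\<lambda>y. inv_into unit_square f y - inv_into unit_square g y)
       + \<bar>1 / (M - real_of_ereal (Var f unit_square)) - 1 / (M - real_of_ereal (Var g unit_square))\<bar>
     else 0)"

definition null_to_full :: "real \<Rightarrow> (real^2 \<Rightarrow> real^2) set"
  where "null_to_full M =
    {f \<in> BV_homeos M. \<exists>E. E \<in> sets borel \<and> E \<subseteq> unit_square \<and>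
                    emeasure lebesgue E = 0 \<and> emeasure lebesgue (f ` E) = 1}"

definition residual_in :: "'a topology \<Rightarrow> 'a set \<Rightarrow> bool"
  where "residual_in T S \<longleftrightarrow> S \<subseteq> topspace T \<and>
    (\<exists>\<G>. countable \<G> \<and>
         (\<forall>U\<in>\<G>. openin T U \<and> T closure_of U = topspace T) \<and>
         topspace T \<inter> \<Inter>\<G> \<subseteq> S)"


lemma unit_square_nonempty: "unit_square \<noteq> {}"
proof -
  have "(\<chi> i. 1/2) \<in> unit_square"
    by (simp add: unit_square_def mem_box_cart)
  then show ?thesis by blast
qed

lemma bounded_unit_square: "bounded unit_square"
  by (simp add: unit_square_def)

context
  fixes f g :: "real^2 \<Rightarrow> real^2"
  assumes fg: "f ` unit_square \<subseteq> unit_square" "g ` unit_square \<subseteq> unit_square"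
begin

lemma bdd_above_diff: "bdd_above ((\<lambda>x. norm (f x - g x)) ` unit_square)"
proof -
  obtain B where B: "\<And>x. x \<in> unit_square \<Longrightarrow> norm x \<le> B"
    using bounded_unit_square by (auto simp: bounded_iff)
  show ?thesis
  proof (rule bdd_aboveI2)
    fix x assume "x \<in> unit_square"
    then have "norm (f x) \<le> B" "norm (g x) \<le> B"
      using fg B by auto
    then show "norm (f x - g x) \<le> 2 * B"
      using norm_triangle_ineq4[of "f x" "g x"] by linarith
  qed
qed

lemma norm_le_sup_norm_on:
  "x \<in> unit_square \<Longrightarrow> norm (f x - g x) \<le> sup_norm_on unit_square (\<lambda>x. f x - g x)"
  unfolding sup_norm_on_def by (rule cSUP_upper[OF _ bdd_above_diff])

lemma sup_norm_on_nonneg: "0 \<le> sup_norm_on unit_square (\<lambda>x. f x - g x)"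
  using norm_le_sup_norm_on unit_square_nonempty
  by (meson all_not_in_conv norm_ge_zero order_trans)

end

lemma sup_norm_on_triangle:
  assumes "f ` unit_square \<subseteq> unit_square" "g ` unit_square \<subseteq> unit_square"
    "h ` unit_square \<subseteq> unit_square"
  shows "sup_norm_on unit_square (\<lambda>x. f x - h x)
    \<le> sup_norm_on unit_square (\<lambda>x. f x - g x) + sup_norm_on unit_square (\<lambda>x. g x - h x)"
  unfolding sup_norm_on_def[of _ "\<lambda>x. f x - h x"]
proof (rule cSUP_least[OF unit_square_nonempty])
  fix x assume x: "x \<in> unit_square"
  have "norm (f x - h x) \<le> norm (f x - g x) + norm (g x - h x)"
    using norm_triangle_ineq[of "f x - g x" "g x - h x"] by simp
  also have "\<dots> \<le> sup_norm_on unit_square (\<lambda>x. f x - g x) + sup_norm_on unit_square (\<lambda>x. g x - h x)"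
    by (intro add_mono norm_le_sup_norm_on assms x)
  finally show "norm (f x - h x) \<le> \<dots>" .
qed

lemma sup_norm_on_commute:
  "sup_norm_on S (\<lambda>x. f x - g x) = sup_norm_on S (\<lambda>x. g x - f x)"
  by (simp add: sup_norm_on_def norm_minus_commute)

lemma BV_homeos_image:
  assumes "f \<in> BV_homeos M"
  shows "f ` unit_square \<subseteq> unit_square" "inv_into unit_square f ` unit_square \<subseteq> unit_square"
  using assms by (auto simp: BV_homeos_def homeomorphism_def)

lemma Metric_space_BV_homeos: "Metric_space (BV_homeos M) (dX M)"
proof
  fix f g
  show "0 \<le> dX M f g"
    by (simp add: dX_def add_nonneg_nonneg sup_norm_on_nonneg BV_homeos_image[where M=M])
  show "dX M f g = dX M g f"
    unfolding dX_def
    by (simp add: sup_norm_on_commute[of _ f] sup_norm_on_commute[of _ "inv_into unit_square f"]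
        abs_minus_commute)
next
  fix f g assume fg: "f \<in> BV_homeos M" "g \<in> BV_homeos M"
  show "dX M f g = 0 \<longleftrightarrow> f = g"
  proof
    assume "dX M f g = 0"
    moreover have "0 \<le> sup_norm_on unit_square (\<lambda>x. f x - g x)"
      "0 \<le> sup_norm_on unit_square (\<lambda>y. inv_into unit_square f y - inv_into unit_square g y)"
      by (rule sup_norm_on_nonneg; rule BV_homeos_image; rule fg)+
    ultimately have "sup_norm_on unit_square (\<lambda>x. f x - g x) = 0"
      using fg by (simp add: dX_def)
    then have "f x = g x" if "x \<in> unit_square" for x
      using norm_le_sup_norm_on[OF BV_homeos_image(1)[OF fg(1)] BV_homeos_image(1)[OF fg(2)] that] by simp
    then show "f = g"
      using fg by (auto simp: BV_homeos_def intro: extensionalityI)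
  next
    assume "f = g"
    then show "dX M f g = 0"
      using unit_square_nonempty by (simp add: dX_def sup_norm_on_def)
  qed
next
  fix f g h assume fgh: "f \<in> BV_homeos M" "g \<in> BV_homeos M" "h \<in> BV_homeos M"
  have "sup_norm_on unit_square (\<lambda>x. f x - h x)
    \<le> sup_norm_on unit_square (\<lambda>x. f x - g x) + sup_norm_on unit_square (\<lambda>x. g x - h x)"
    by (rule sup_norm_on_triangle; rule BV_homeos_image; rule fgh)
  moreover have "sup_norm_on unit_square (\<lambda>y. inv_into unit_square f y - inv_into unit_square h y)
    \<le> sup_norm_on unit_square (\<lambda>y. inv_into unit_square f y - inv_into unit_square g y)
      + sup_norm_on unit_square (\<lambda>y. inv_into unit_square g y - inv_into unit_square h y)"
    by (rule sup_norm_on_triangle; rule BV_homeos_image; rule fgh)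
  ultimately show "dX M f h \<le> dX M f g + dX M g h"
    using fgh by (simp add: dX_def)
qed

end

theory Submission
  imports Defs
begin

text \<open>For $\delta > 0$ consider the $f \in X$ for which some open $V$ with $|V| < \delta$ contains
  $f^{-1}(K)$ for some compact $K$ with $|K| > 1 - \delta$. These maps form an open set, because $d_X$
  controls $f^{-1}$ uniformly, and by Borel--Cantelli a map in all of these sets (for
  $\delta = 2^{-n}$) lies in $A$.

  For density, perturb $f$ to $g_k = f \circ h_k$, $k < N$, where
  $h_k^{-1}(x, y) = (x + \tau(y) p_k(x), y)$, the cutoff $\tau$ vanishes at $y = 0, 1$, and the
  uniformly small $p_k$ have derivative close to $-1$ off a set $T_k$; so $h_k^{-1}$ compresses
  almost everything with $x \notin T_k$ into a set of small measure. The bumps of $1 + p'_k$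
  for different $k$ are shifts of each other, so $\sum_k p'_k \le 2$ and every point is in at most
  three $T_k$. Pulling back test fields by the Piola transform turns the first property into
  $\frac1N \sum_k Var(g_k) \le (1 + o(1)) Var(f)$, while $\sum_k |f(T_k \times (0,1))| \le 3$. Hence for
  some $k$ both $Var(g_k)$ is at most slightly larger than $Var(f)$ and $f(T_k \times (0,1))$ is small;
  a lower bound for $Var(g_k)$ holds by lower semicontinuity.\<close>

section \<open>Splines\<close>

text \<open>Compressing almost the whole square forces expansion on the remaining strips, and a BV
  map may carry most of its vertical variation exactly there: on its bumps 1 + p' is of order N, so
  one fixed shear could multiply the variation by that order. Moving the bumps through N positions
  removes the danger, since the variation cannot sit in all of them at once. Only the vertical
  component of a test field is rescaled by 1 + \<tau> p'; the horizontal one keeps its size up to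
  \<bar>\<tau>' p\<bar>. The maximum norm on the fields allows the components to be bounded
  separately, and only then do expansion and compression cancel in the sum over k. The cutoff is
  forced by the identity on the boundary. Its slope does no harm, because p can be made small after
  \<tau> has been fixed. Splines serve for two reasons: a pulled-back field contains first
  derivatives of the shear, so the shear has to be C^2 for the field to be C^1; and the translates
  of a B-spline sum to exactly 1. The overlap number 3 is the width of the quadratic
  B-spline.\<close>

definition trunc_pow :: "nat \<Rightarrow> real \<Rightarrow> real"
  where "trunc_pow n x = max 0 x ^ n / fact n"

lemma DERIV_trunc_pow:
  assumes "1 \<le> n"
  shows "(trunc_pow (Suc n) has_real_derivative trunc_pow n x) (at x)"
proof -
  have pos: "(trunc_pow (Suc n) has_real_derivative trunc_pow n x) (at x)" if "x > 0"
  proof (rule has_field_derivative_transform_within[where d = x and f = "\<lambda>x. x ^ Suc n / fact (Suc n)"])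
    show "((\<lambda>x. x ^ Suc n / fact (Suc n)) has_real_derivative trunc_pow n x) (at x)"
      using that by (auto simp: trunc_pow_def divide_simps simp del: power_Suc intro!: derivative_eq_intros)
    show "y ^ Suc n / fact (Suc n) = trunc_pow (Suc n) y" if "dist y x < x" for y
      using that by (simp add: trunc_pow_def dist_real_def max_def)
  qed (use that in auto)
  have neg: "(trunc_pow (Suc n) has_real_derivative trunc_pow n x) (at x)" if "x < 0"
  proof (rule has_field_derivative_transform_within[where d = "-x" and f = "\<lambda>x. 0"])
    show "((\<lambda>x. 0) has_real_derivative trunc_pow n x) (at x)"
      using that assms by (auto simp: trunc_pow_def max_def power_0_left)
    show "0 = trunc_pow (Suc n) y" if "dist y x < -x" for y
      using that by (simp add: trunc_pow_def dist_real_def max_def)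
  qed (use that in auto)
  have zero: "(trunc_pow (Suc n) has_real_derivative trunc_pow n 0) (at 0)"
  proof -
    have "((\<lambda>h. trunc_pow (Suc n) h / h) \<longlongrightarrow> 0) (at 0)"
    proof (rule tendsto_rabs_zero_cancel[OF tendsto_sandwich[of "\<lambda>_. 0"]])
      have "\<bar>trunc_pow (Suc n) h / h\<bar> \<le> \<bar>h\<bar> ^ n / fact (Suc n)" for h
        by (cases "0 \<le> h") (auto simp: trunc_pow_def max_def abs_mult)
      then show "\<forall>\<^sub>F h in at 0. \<bar>trunc_pow (Suc n) h / h\<bar> \<le> \<bar>h\<bar> ^ n / fact (Suc n)"
        by (intro always_eventually allI)
      show "((\<lambda>h::real. \<bar>h\<bar> ^ n / fact (Suc n)) \<longlongrightarrow> 0) (at 0)"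
        using assms by (auto intro!: tendsto_eq_intros)
    qed auto
    then show ?thesis
      using assms by (simp add: DERIV_def trunc_pow_def power_0_left)
  qed
  show ?thesis
    using pos neg zero by (cases x "0::real" rule: linorder_cases) auto
qed

lemma continuous_trunc_pow: "continuous_on A (trunc_pow n)"
  unfolding trunc_pow_def by (intro continuous_intros) auto

lemma DERIV_trunc_pow_shift:
  "1 \<le> n \<Longrightarrow> ((\<lambda>x. trunc_pow (Suc n) (x - c)) has_real_derivative trunc_pow n (x - c)) (at x)"
  using DERIV_trunc_pow[of n "x - c"] DERIV_shift[of "trunc_pow (Suc n)" _ x "- c"] by simp

text \<open>\<open>spline 3\<close> is a $C^2$ step from 0 to 1 with derivative \<open>spline 2\<close>, the quadratic
  B-spline supported in $[0,3]$ whose integer translates sum to 1.\<close>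

definition spline :: "nat \<Rightarrow> real \<Rightarrow> real"
  where "spline n x = trunc_pow n x - 3 * trunc_pow n (x - 1) + 3 * trunc_pow n (x - 2) - trunc_pow n (x - 3)"

lemma DERIV_spline:
  assumes "1 \<le> n"
  shows "(spline (Suc n) has_real_derivative spline n x) (at x)"
  unfolding spline_def[abs_def] using assms
  by (auto intro!: derivative_eq_intros DERIV_trunc_pow_shift DERIV_trunc_pow)

lemma continuous_spline: "continuous_on A (spline n)"
  unfolding spline_def[abs_def]
  by (intro continuous_intros continuous_on_compose2[OF continuous_trunc_pow[of UNIV]]) auto

lemma spline_left: "1 \<le> n \<Longrightarrow> x \<le> 0 \<Longrightarrow> spline n x = 0"
  by (simp add: spline_def trunc_pow_def max_def)

lemma spline_3_right: "3 \<le> x \<Longrightarrow> spline 3 x = 1"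
  by (simp add: spline_def trunc_pow_def max_def fact_numeral field_simps power3_eq_cube power2_eq_square)

lemma spline_2_right: "3 \<le> x \<Longrightarrow> spline 2 x = 0"
  by (simp add: spline_def trunc_pow_def max_def fact_numeral field_simps power3_eq_cube power2_eq_square)

text \<open>This is the antiderivative of the hat function on [0,2], a monotone step from 0 to 1.
  The quadratic B-spline is the difference of two of its integer translates, so sums of B-spline
  translates telescope.\<close>

definition step2 :: "real \<Rightarrow> real"
  where "step2 x = trunc_pow 2 x - 2 * trunc_pow 2 (x - 1) + trunc_pow 2 (x - 2)"

lemma spline_2_eq_diff: "spline 2 x = step2 x - step2 (x - 1)"
  by (simp add: spline_def step2_def algebra_simps)

lemma step2_bounds: "0 \<le> step2 x" "step2 x \<le> 1"
proof -
  consider "x \<le> 0" | "0 < x" "x \<le> 1" | "1 < x" "x \<le> 2" | "x > 2" by linarith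
  then have "0 \<le> step2 x \<and> step2 x \<le> 1"
  proof cases
    case 1
    then show ?thesis by (simp add: step2_def trunc_pow_def max_def)
  next
    case 2
    then have "x\<^sup>2 \<le> 1" by (simp add: power_le_one)
    then show ?thesis using 2 by (simp add: step2_def trunc_pow_def max_def)
  next
    case 3
    have "step2 x = 1 - (2 - x)\<^sup>2 / 2"
      using 3 by (simp add: step2_def trunc_pow_def max_def power2_eq_square field_simps)
    moreover have "(2 - x)\<^sup>2 \<le> 1" using 3 by (intro power_le_one) auto
    ultimately show ?thesis by auto
  next
    case 4
    then show ?thesis
      by (simp add: step2_def trunc_pow_def max_def power2_eq_square field_simps)
  qed
  then show "0 \<le> step2 x" "step2 x \<le> 1" by auto
qed

lemma spline_2_nonneg: "0 \<le> spline 2 x"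
proof -
  consider "x \<le> 0" | "0 < x" "x \<le> 1" | "1 < x" "x \<le> 2" | "2 < x" "x \<le> 3" | "x > 3" by linarith
  then show ?thesis
  proof cases
    case 1
    then show ?thesis by (simp add: spline_left)
  next
    case 2
    then show ?thesis by (simp add: spline_def trunc_pow_def max_def)
  next
    case 3
    have "spline 2 x = 3/4 - (x - 3/2)\<^sup>2"
      using 3 by (simp add: spline_def trunc_pow_def max_def power2_eq_square field_simps)
    moreover have "\<bar>x - 3/2\<bar> \<le> 1/2" using 3 by (auto simp: abs_if)
    then have "(x - 3/2)\<^sup>2 \<le> (1/2)\<^sup>2" by (metis abs_ge_zero power2_abs power_mono)
    ultimately show ?thesis by (simp add: power2_eq_square)
  next
    case 4
    have "spline 2 x = (3 - x)\<^sup>2 / 2"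
      using 4 by (simp add: spline_def trunc_pow_def max_def power2_eq_square field_simps)
    moreover have "0 \<le> (3 - x)\<^sup>2" by simp
    ultimately show ?thesis by linarith
  next
    case 5
    then show ?thesis by (simp add: spline_2_right)
  qed
qed

lemma sum_spline_2_le_1: "(\<Sum>j<n. spline 2 (y - real j)) \<le> 1"
proof -
  have "(\<Sum>j<n. spline 2 (y - real j)) = step2 y - step2 (y - real n)"
  proof (induction n)
    case (Suc n)
    have "y - real n - 1 = y - (1 + real n)" by simp
    then have "step2 (y - real n - 1) = step2 (y - real (Suc n))"
      by (simp only: of_nat_Suc)
    then show ?case using Suc by (simp add: spline_2_eq_diff del: of_nat_Suc)
  qed simp
  then show ?thesis using step2_bounds[of y] step2_bounds[of "y - real n"] by linarith
qed

lemma DERIV_spline_3: "(spline 3 has_real_derivative spline 2 x) (at x)"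
  using DERIV_spline[of 2 x] by (simp add: numeral_eq_Suc)

lemma DERIV_spline_2: "(spline 2 has_real_derivative spline 1 x) (at x)"
  using DERIV_spline[of 1 x] by (simp add: numeral_eq_Suc)

lemma spline_3_mono: "x \<le> y \<Longrightarrow> spline 3 x \<le> spline 3 y"
  by (rule DERIV_nonneg_imp_nondecreasing) (use DERIV_spline_3 spline_2_nonneg in blast)+

lemma spline_3_bounds: "0 \<le> spline 3 x" "spline 3 x \<le> 1"
proof -
  show "0 \<le> spline 3 x"
    using spline_3_mono[of "min 0 x" x] spline_left[of 3 "min 0 x"] by simp
  show "spline 3 x \<le> 1"
    using spline_3_mono[of x "max 3 x"] spline_3_right[of "max 3 x"] by simp
qed

section \<open>Perturbations of the identity on the line\<close>

lemma card_nat_between: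
  fixes y :: real and c :: nat
  assumes "\<And>j. j \<in> A \<Longrightarrow> y - c < real j \<and> real j < y"
  shows "card A \<le> c"
proof -
  have "int ` A \<subseteq> {\<lfloor>y - c\<rfloor> + 1..\<lfloor>y - c\<rfloor> + int c}"
  proof
    fix z assume "z \<in> int ` A"
    then obtain j where j: "z = int j" "j \<in> A" by auto
    have "y - c < real_of_int z" "real_of_int z < y" using assms[OF j(2)] j by auto
    then show "z \<in> {\<lfloor>y - c\<rfloor> + 1..\<lfloor>y - c\<rfloor> + int c}"
      by (auto simp: floor_less_iff) linarith+
  qed
  then have "card (int ` A) \<le> card {\<lfloor>y - c\<rfloor> + 1..\<lfloor>y - c\<rfloor> + int c}"
    by (intro card_mono) auto
  then show ?thesis by (simp add: card_image)
qed

text \<open>Only the term with index floor(x) can lie strictly between 0 and 1; the earlier ones are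
  1 and the later ones 0, so the sum and x both lie in [floor(x), floor(x) + 1]. With rescaled
  copies of \<open>spline 3\<close> as steps this keeps the perturbations below 1/m.\<close>

lemma sum_unit_steps_bounds:
  fixes F :: "nat \<Rightarrow> real"
  assumes "0 \<le> x" "x \<le> real m"
    and "\<And>i. 0 \<le> F i" "\<And>i. F i \<le> 1"
    and "\<And>i. real i + 1 \<le> x \<Longrightarrow> F i = 1" "\<And>i. x \<le> real i \<Longrightarrow> F i = 0"
  shows "\<bar>(\<Sum>i<m. F i) - x\<bar> \<le> 1"
proof -
  define j where "j = nat \<lfloor>x\<rfloor>"
  have j: "real j \<le> x" "x < real j + 1" using assms(1) by (auto simp: j_def)
  then have jm: "j \<le> m" using assms(2) by linarith
  have "(\<Sum>i<m. F i) = (\<Sum>i<j. F i) + (\<Sum>i=j..<m. F i)"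
    using jm by (simp add: sum.atLeastLessThan_concat flip: atLeast0LessThan)
  moreover have "(\<Sum>i<j. F i) = (\<Sum>i<j. 1)"
    using j(1) by (intro sum.cong refl assms(5)) auto
  moreover have "0 \<le> (\<Sum>i=j..<m. F i)" by (intro sum_nonneg assms)
  moreover have "(\<Sum>i=j..<m. F i) \<le> (\<Sum>i=j..<m. if i = j then 1 else 0)"
  proof (rule sum_mono)
    fix i assume "i \<in> {j..<m}"
    then show "F i \<le> (if i = j then 1 else 0)"
      using j(2) assms(4)[of i] assms(6)[of i] by (cases "i = j") auto
  qed
  ultimately show ?thesis using j by (auto split: if_splits)
qed

text \<open>In each of \<open>m\<close> cells of length $1/m$ the function $1 + p'_k$ has one bump, placed in the
  \<open>k\<close>-th of $N + 2$ slots; it is \<open>\<eta>\<close> away from the bumps.\<close>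

lemma perturbation_family:
  fixes m N :: nat and \<eta> :: real
  assumes "1 \<le> m" "1 \<le> N" "0 < \<eta>" "\<eta> < 1"
  obtains p p' p'' :: "nat \<Rightarrow> real \<Rightarrow> real" and T :: "nat \<Rightarrow> real set"
  where "\<And>k u. (p k has_real_derivative p' k u) (at u)"
    "\<And>k u. (p' k has_real_derivative p'' k u) (at u)"
    "\<And>k. continuous_on UNIV (p'' k)"
    "\<And>k. p k 0 = 0" "\<And>k. k < N \<Longrightarrow> p k 1 = 0"
    "\<And>k u. k < N \<Longrightarrow> 0 \<le> u \<Longrightarrow> u \<le> 1 \<Longrightarrow> \<bar>p k u\<bar> \<le> 1 / real m"
    "\<And>k u. \<eta> - 1 \<le> p' k u"
    "\<And>k. open (T k)" "\<And>k u. u \<notin> T k \<Longrightarrow> p' k u = \<eta> - 1"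
    "\<And>u. card {k. k < N \<and> u \<in> T k} \<le> 3"
    "\<And>u. (\<Sum>k<N. 1 + p' k u) \<le> real N + 2"
proof -
  \<comment> \<open>A bump is three slots wide, so two extra slots let the bump that starts in slot
    N - 1 end inside its cell; hence each perturbation is back at 0 at the end of the cell.\<close>
  define K where "K = real N + 2"
  define z where "z i k u = K * real m * u - (K * real i + real k)" for i k u
  define p where "p k u = (\<eta> - 1) * u + (1 - \<eta>) / real m * (\<Sum>i<m. spline 3 (z i k u))" for k u
  define p' where "p' k u = (\<eta> - 1) + (1 - \<eta>) * K * (\<Sum>i<m. spline 2 (z i k u))" for k u
  define p'' where "p'' k u = (1 - \<eta>) * K * (\<Sum>i<m. K * real m * spline 1 (z i k u))" for k u
  define T where "T k = (\<Union>i<m. {u. 0 < z i k u \<and> z i k u < 3})" for k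
  have K: "K \<ge> 3" using assms by (simp add: K_def)
  have dz: "((\<lambda>u. z i k u) has_real_derivative K * real m) (at u)" for i k u
    unfolding z_def by (auto intro!: derivative_eq_intros)
  have cz: "continuous_on UNIV (\<lambda>u. z i k u)" for i k
    unfolding z_def by (intro continuous_intros)
  have z_nonpos: "z i k u \<le> 0" if "real m * u \<le> real i" for i k u
  proof -
    have "K * (real m * u) \<le> K * real i" using that K by (intro mult_left_mono) auto
    then show ?thesis by (simp add: z_def)
  qed
  have z_ge3: "3 \<le> z i k u" if "real i + 1 \<le> real m * u" "k < N" for i k u
  proof -
    have "K * (real i + 1) \<le> K * (real m * u)" using that K by (intro mult_left_mono) auto
    moreover have "real k + 1 \<le> real N" using that by linarith
    ultimately show ?thesis by (simp add: z_def K_def algebra_simps)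
  qed
  show ?thesis
  proof (rule that[of p p' p'' T])
    show "(p k has_real_derivative p' k u) (at u)" for k u
    proof -
      have "((\<lambda>u. \<Sum>i<m. spline 3 (z i k u)) has_real_derivative
          (\<Sum>i<m. spline 2 (z i k u) * (K * real m))) (at u)"
        by (intro DERIV_sum DERIV_chain2[OF DERIV_spline_3] dz)
      then have "(p k has_real_derivative (\<eta> - 1) * 1 +
          (1 - \<eta>) / real m * (\<Sum>i<m. spline 2 (z i k u) * (K * real m))) (at u)"
        unfolding p_def[abs_def] by (intro DERIV_add DERIV_cmult DERIV_ident)
      moreover have "(\<Sum>i<m. spline 2 (z i k u) * (K * real m)) = K * real m * (\<Sum>i<m. spline 2 (z i k u))"
        by (simp add: sum_distrib_left mult.commute)
      ultimately show ?thesis using assms by (simp add: p'_def mult.assoc)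
    qed
    show "(p' k has_real_derivative p'' k u) (at u)" for k u
    proof -
      have "((\<lambda>u. \<Sum>i<m. spline 2 (z i k u)) has_real_derivative
          (\<Sum>i<m. spline 1 (z i k u) * (K * real m))) (at u)"
        by (intro DERIV_sum DERIV_chain2[OF DERIV_spline_2] dz)
      then have "(p' k has_real_derivative 0 +
          (1 - \<eta>) * K * (\<Sum>i<m. spline 1 (z i k u) * (K * real m))) (at u)"
        unfolding p'_def[abs_def] by (intro DERIV_add DERIV_cmult DERIV_const)
      then show ?thesis by (simp add: p''_def mult.commute)
    qed
    show "continuous_on UNIV (p'' k)" for k
      unfolding p''_def[abs_def]
      by (intro continuous_intros continuous_on_compose2[OF continuous_spline[of UNIV] cz]) auto
    show "p k 0 = 0" for k
      using z_nonpos[of 0] by (simp add: p_def spline_left)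
    show "p k 1 = 0" if "k < N" for k
    proof -
      have "(\<Sum>i<m. spline 3 (z i k 1)) = (\<Sum>i<m. 1)"
        using that by (intro sum.cong refl spline_3_right z_ge3) auto
      then show ?thesis using assms by (simp add: p_def field_simps)
    qed
    show "\<bar>p k u\<bar> \<le> 1 / real m" if "k < N" "0 \<le> u" "u \<le> 1" for k u
    proof -
      have "\<bar>(\<Sum>i<m. spline 3 (z i k u)) - real m * u\<bar> \<le> 1"
        using that by (intro sum_unit_steps_bounds spline_3_bounds spline_3_right z_ge3 spline_left z_nonpos)
            (auto intro: mult_left_le)
      moreover have "p k u = (1 - \<eta>) / real m * ((\<Sum>i<m. spline 3 (z i k u)) - real m * u)"
        using assms by (simp add: p_def field_simps)
      ultimately have "\<bar>p k u\<bar> \<le> (1 - \<eta>) / real m * 1"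
        using assms by (simp add: abs_mult divide_right_mono mult_left_le)
      also have "\<dots> \<le> 1 / real m" using assms by (simp add: divide_right_mono)
      finally show ?thesis .
    qed
    have sp: "0 \<le> (1 - \<eta>) * K * (\<Sum>i<m. spline 2 (z i k u))" for k u
      using assms K by (intro mult_nonneg_nonneg sum_nonneg spline_2_nonneg) auto
    then show "\<eta> - 1 \<le> p' k u" for k u
      by (simp add: p'_def)
    show "open (T k)" for k
      unfolding T_def
      by (intro open_UN ballI open_Collect_conj open_Collect_less cz continuous_on_const)
    show "p' k u = \<eta> - 1" if "u \<notin> T k" for k u
    proof -
      have "spline 2 (z i k u) = 0" if "i < m" for i
        using \<open>u \<notin> T k\<close> that spline_left[of 2 "z i k u"] spline_2_right[of "z i k u"]
        by (force simp: T_def)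
      then show ?thesis by (simp add: p'_def)
    qed
    define M where "M = N + 2"
    have KM: "K = real M" by (simp add: K_def M_def)
    show "card {k. k < N \<and> u \<in> T k} \<le> 3" for u
    proof -
      \<comment> \<open>Numbering the slots of all cells consecutively by j = i * M + k turns all
        bumps into integer translates of a single spline; k is recovered as j mod M. The same
        numbering flattens the double sum in the last claim.\<close>
      define A where "A = {j. j < m * M \<and> 0 < K * real m * u - real j \<and> K * real m * u - real j < 3}"
      have "{k. k < N \<and> u \<in> T k} \<subseteq> (\<lambda>j. j mod M) ` A"
      proof
        fix k assume "k \<in> {k. k < N \<and> u \<in> T k}"
        then obtain i where i: "k < N" "i < m" "0 < z i k u" "z i k u < 3" by (auto simp: T_def)
        have "i * M + k < Suc i * M" using i by (simp add: M_def)
        also have "\<dots> \<le> m * M" using i by (intro mult_right_mono) auto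
        finally have "i * M + k \<in> A" using i by (simp add: A_def z_def KM algebra_simps)
        moreover have "k < M" using i by (simp add: M_def)
        then have "k = (i * M + k) mod M" by simp
        ultimately show "k \<in> (\<lambda>j. j mod M) ` A" by blast
      qed
      moreover have "finite A" by (simp add: A_def)
      ultimately have "card {k. k < N \<and> u \<in> T k} \<le> card A"
        by (meson card_image_le card_mono finite_imageI order_trans)
      also have "card A \<le> 3"
        by (rule card_nat_between[where y = "K * real m * u"]) (auto simp: A_def)
      finally show ?thesis .
    qed
    show "(\<Sum>k<N. 1 + p' k u) \<le> real N + 2" for u
    proof -
      have "(\<Sum>k<N. \<Sum>i<m. spline 2 (z i k u)) \<le> (\<Sum>k<M. \<Sum>i<m. spline 2 (z i k u))"
        by (intro sum_mono2 sum_nonneg spline_2_nonneg) (auto simp: M_def)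
      also have "\<dots> = (\<Sum>i<m. \<Sum>k<M. spline 2 (z i k u))" by (rule sum.swap)
      also have "\<dots> = (\<Sum>i<m. \<Sum>j=i*M..<i*M+M. spline 2 (K * real m * u - real j))"
      proof (rule sum.cong[OF refl])
        fix i
        have "(\<Sum>j=i*M..<i*M+M. spline 2 (K * real m * u - real j))
            = (\<Sum>k=0..<M. spline 2 (K * real m * u - real (k + i * M)))"
          using sum.shift_bounds_nat_ivl[of "\<lambda>j. spline 2 (K * real m * u - real j)" 0 "i*M" M]
          by (simp add: add.commute)
        then show "(\<Sum>k<M. spline 2 (z i k u)) = (\<Sum>j=i*M..<i*M+M. spline 2 (K * real m * u - real j))"
          by (simp add: z_def KM lessThan_atLeast0 algebra_simps)
      qed
      also have "\<dots> = (\<Sum>j<m * M. spline 2 (K * real m * u - real j))" by (rule sum.nat_group)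
      also have "\<dots> \<le> 1" by (rule sum_spline_2_le_1)
      finally have *: "(\<Sum>k<N. \<Sum>i<m. spline 2 (z i k u)) \<le> 1" .
      have "(\<Sum>k<N. 1 + p' k u) = real N * \<eta> + (1 - \<eta>) * K * (\<Sum>k<N. \<Sum>i<m. spline 2 (z i k u))"
        by (simp add: p'_def sum.distrib sum_distrib_left)
      also have "\<dots> \<le> real N * \<eta> + (1 - \<eta>) * K * 1"
        using * assms K by (intro add_left_mono mult_left_mono) auto
      also have "\<dots> \<le> real N + 2" using assms by (simp add: K_def algebra_simps)
      finally show ?thesis .
    qed
  qed
qed

section \<open>Compactly supported fields and the variation\<close>

text \<open>In finite dimension a derivative is continuous in the operator norm as soon as its value
  at each fixed vector is. Any compact subset of U outside of which the field vanishes may replace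
  the closure of the support, which is easier to follow through sums and pullbacks.\<close>

lemma C1_compact_support_iff:
  fixes \<phi> :: "'a::euclidean_space \<Rightarrow> 'b::real_normed_vector"
  shows "\<phi> \<in> C1_compact_support U \<longleftrightarrow>
    (\<exists>D. (\<forall>x\<in>U. (\<phi> has_derivative D x) (at x)) \<and> (\<forall>e. continuous_on U (\<lambda>x. D x e))) \<and>
    (\<exists>K. compact K \<and> K \<subseteq> U \<and> (\<forall>x\<in>U - K. \<phi> x = 0))" (is "?L \<longleftrightarrow> ?R")
proof
  assume ?L
  then obtain \<phi>' :: "'a \<Rightarrow> 'a \<Rightarrow>\<^sub>L 'b"
    where \<phi>': "\<forall>x\<in>U. (\<phi> has_derivative blinfun_apply (\<phi>' x)) (at x)" "continuous_on U \<phi>'"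
      and supp: "compact (closure {x\<in>U. \<phi> x \<noteq> 0})" "closure {x\<in>U. \<phi> x \<noteq> 0} \<subseteq> U"
    by (auto simp: C1_compact_support_def)
  have "continuous_on U (\<lambda>x. blinfun_apply (\<phi>' x) e)" for e
    by (intro continuous_intros \<phi>')
  moreover have "\<forall>x\<in>U - closure {x\<in>U. \<phi> x \<noteq> 0}. \<phi> x = 0"
    using closure_subset[of "{x\<in>U. \<phi> x \<noteq> 0}"] by blast
  ultimately show ?R using \<phi>'(1) supp
    by (intro conjI exI[of _ "\<lambda>x. blinfun_apply (\<phi>' x)"] exI[of _ "closure {x\<in>U. \<phi> x \<noteq> 0}"] allI) blast+
next
  assume ?R
  then obtain D K where D: "\<And>x. x \<in> U \<Longrightarrow> (\<phi> has_derivative D x) (at x)"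
      "\<And>e. continuous_on U (\<lambda>x. D x e)"
    and K: "compact K" "K \<subseteq> U" "\<And>x. x \<in> U - K \<Longrightarrow> \<phi> x = 0" by metis
  have app: "blinfun_apply (Blinfun (D x)) = D x" if "x \<in> U" for x
    using D(1)[OF that] by (intro bounded_linear_Blinfun_apply has_derivative_bounded_linear)
  have "continuous_on U (\<lambda>x. Blinfun (D x))"
  proof (rule continuous_on_blinfun_componentwise)
    fix i :: 'a
    show "continuous_on U (\<lambda>x. blinfun_apply (Blinfun (D x)) i)"
      using D(2)[of i] app by (simp cong: continuous_on_cong)
  qed
  moreover have "\<forall>x\<in>U. (\<phi> has_derivative blinfun_apply (Blinfun (D x))) (at x)"
    using D(1) app by simp
  moreover have "closure {x\<in>U. \<phi> x \<noteq> 0} \<subseteq> K"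
    using K by (intro closure_minimal compact_imp_closed) auto
  moreover have "compact (closure {x\<in>U. \<phi> x \<noteq> 0})"
    using K calculation(3) by (meson closed_closure compact_closure bounded_subset compact_imp_bounded
        closure_subset order_trans)
  ultimately show ?L
    using K(2) unfolding C1_compact_support_def
    by (intro CollectI conjI exI[of _ "\<lambda>x. Blinfun (D x)"]) blast+
qed

lemma C1_compact_supportE:
  fixes \<phi> :: "'a::euclidean_space \<Rightarrow> 'b::real_normed_vector"
  assumes "\<phi> \<in> C1_compact_support U"
  obtains D K where "\<And>x. x \<in> U \<Longrightarrow> (\<phi> has_derivative D x) (at x)" "\<And>e. continuous_on U (\<lambda>x. D x e)"
    "compact K" "K \<subseteq> U" "\<And>x. x \<in> U \<Longrightarrow> x \<notin> K \<Longrightarrow> \<phi> x = 0"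
  using assms unfolding C1_compact_support_iff by blast

lemma C1_compact_supportI:
  fixes \<phi> :: "'a::euclidean_space \<Rightarrow> 'b::real_normed_vector"
  assumes "\<And>x. x \<in> U \<Longrightarrow> (\<phi> has_derivative D x) (at x)" "\<And>e. continuous_on U (\<lambda>x. D x e)"
    "compact K" "K \<subseteq> U" "\<And>x. x \<in> U \<Longrightarrow> x \<notin> K \<Longrightarrow> \<phi> x = 0"
  shows "\<phi> \<in> C1_compact_support U"
  using assms unfolding C1_compact_support_iff by blast

lemma C1_compact_support_fst:
  fixes \<phi> :: "'a::euclidean_space \<Rightarrow> 'b::real_normed_vector \<times> 'c::real_normed_vector"
  assumes "\<phi> \<in> C1_compact_support U"
  shows "(\<lambda>x. fst (\<phi> x)) \<in> C1_compact_support U"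
proof -
  obtain D K where D: "\<And>x. x \<in> U \<Longrightarrow> (\<phi> has_derivative D x) (at x)" "\<And>e. continuous_on U (\<lambda>x. D x e)"
    "compact K" "K \<subseteq> U" "\<And>x. x \<in> U \<Longrightarrow> x \<notin> K \<Longrightarrow> \<phi> x = 0"
    using assms by (rule C1_compact_supportE) blast
  show ?thesis
    by (rule C1_compact_supportI[where D = "\<lambda>x t. fst (D x t)" and K = K])
       (auto intro!: has_derivative_fst continuous_on_fst D(1,2,3) simp: D(5) dest: subsetD[OF D(4)])
qed

lemma C1_compact_support_snd:
  fixes \<phi> :: "'a::euclidean_space \<Rightarrow> 'b::real_normed_vector \<times> 'c::real_normed_vector"
  assumes "\<phi> \<in> C1_compact_support U"
  shows "(\<lambda>x. snd (\<phi> x)) \<in> C1_compact_support U"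
proof -
  obtain D K where D: "\<And>x. x \<in> U \<Longrightarrow> (\<phi> has_derivative D x) (at x)" "\<And>e. continuous_on U (\<lambda>x. D x e)"
    "compact K" "K \<subseteq> U" "\<And>x. x \<in> U \<Longrightarrow> x \<notin> K \<Longrightarrow> \<phi> x = 0"
    using assms by (rule C1_compact_supportE) blast
  show ?thesis
    by (rule C1_compact_supportI[where D = "\<lambda>x t. snd (D x t)" and K = K])
       (auto intro!: has_derivative_snd continuous_on_snd D(1,2,3) simp: D(5) dest: subsetD[OF D(4)])
qed

lemma C1_compact_support_Pair:
  fixes \<phi> :: "'a::euclidean_space \<Rightarrow> 'b::real_normed_vector" and \<psi> :: "'a \<Rightarrow> 'c::real_normed_vector"
  assumes "\<phi> \<in> C1_compact_support U" "\<psi> \<in> C1_compact_support U"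
  shows "(\<lambda>x. (\<phi> x, \<psi> x)) \<in> C1_compact_support U"
proof -
  obtain D K where D: "\<And>x. x \<in> U \<Longrightarrow> (\<phi> has_derivative D x) (at x)" "\<And>e. continuous_on U (\<lambda>x. D x e)"
    "compact K" "K \<subseteq> U" "\<And>x. x \<in> U \<Longrightarrow> x \<notin> K \<Longrightarrow> \<phi> x = 0"
    using assms(1) by (rule C1_compact_supportE) blast
  obtain E L where E: "\<And>x. x \<in> U \<Longrightarrow> (\<psi> has_derivative E x) (at x)" "\<And>e. continuous_on U (\<lambda>x. E x e)"
    "compact L" "L \<subseteq> U" "\<And>x. x \<in> U \<Longrightarrow> x \<notin> L \<Longrightarrow> \<psi> x = 0"
    using assms(2) by (rule C1_compact_supportE) blast
  show ?thesis
    by (rule C1_compact_supportI[where D = "\<lambda>x t. (D x t, E x t)" and K = "K \<union> L"])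
       (auto intro!: has_derivative_Pair continuous_on_Pair D(1,2,3) E(1,2,3) compact_Un
         simp: D(5) E(5) zero_prod_def dest: subsetD[OF D(4)] subsetD[OF E(4)])
qed

lemma C1_compact_support_scaleR:
  fixes \<phi> :: "'a::euclidean_space \<Rightarrow> 'b::real_normed_vector"
  assumes "\<phi> \<in> C1_compact_support U"
  shows "(\<lambda>x. c *\<^sub>R \<phi> x) \<in> C1_compact_support U"
proof -
  obtain D K where D: "\<And>x. x \<in> U \<Longrightarrow> (\<phi> has_derivative D x) (at x)" "\<And>e. continuous_on U (\<lambda>x. D x e)"
    "compact K" "K \<subseteq> U" "\<And>x. x \<in> U \<Longrightarrow> x \<notin> K \<Longrightarrow> \<phi> x = 0"
    using assms by (rule C1_compact_supportE) blast
  show ?thesis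
    by (rule C1_compact_supportI[where D = "\<lambda>x t. c *\<^sub>R D x t" and K = K])
       (auto intro!: has_derivative_scaleR_right continuous_intros D(1,2,3)
         simp: D(5) dest: subsetD[OF D(4)])
qed

lemma C1_compact_support_0: "(\<lambda>x::'a::euclidean_space. 0) \<in> C1_compact_support U"
  by (rule C1_compact_supportI[where D = "\<lambda>x t. 0" and K = "{}"]) auto

lemma C1_compact_support_add:
  fixes \<phi> \<psi> :: "'a::euclidean_space \<Rightarrow> 'b::real_normed_vector"
  assumes "\<phi> \<in> C1_compact_support U" "\<psi> \<in> C1_compact_support U"
  shows "(\<lambda>x. \<phi> x + \<psi> x) \<in> C1_compact_support U"
proof -
  obtain D K where D: "\<And>x. x \<in> U \<Longrightarrow> (\<phi> has_derivative D x) (at x)" "\<And>e. continuous_on U (\<lambda>x. D x e)"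
    "compact K" "K \<subseteq> U" "\<And>x. x \<in> U \<Longrightarrow> x \<notin> K \<Longrightarrow> \<phi> x = 0"
    using assms(1) by (rule C1_compact_supportE) blast
  obtain E L where E: "\<And>x. x \<in> U \<Longrightarrow> (\<psi> has_derivative E x) (at x)" "\<And>e. continuous_on U (\<lambda>x. E x e)"
    "compact L" "L \<subseteq> U" "\<And>x. x \<in> U \<Longrightarrow> x \<notin> L \<Longrightarrow> \<psi> x = 0"
    using assms(2) by (rule C1_compact_supportE) blast
  show ?thesis
    by (rule C1_compact_supportI[where D = "\<lambda>x t. D x t + E x t" and K = "K \<union> L"])
       (auto intro!: has_derivative_add continuous_on_add D(1,2,3) E(1,2,3) compact_Un
         simp: D(5) E(5) dest: subsetD[OF D(4)] subsetD[OF E(4)])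
qed

lemma C1_compact_support_sum:
  fixes \<phi> :: "'i \<Rightarrow> 'a::euclidean_space \<Rightarrow> 'b::real_normed_vector"
  assumes "\<And>i. i \<in> I \<Longrightarrow> \<phi> i \<in> C1_compact_support U"
  shows "(\<lambda>x. \<Sum>i\<in>I. \<phi> i x) \<in> C1_compact_support U"
  using assms
  by (induction I rule: infinite_finite_induct)
     (auto simp: C1_compact_support_0 intro: C1_compact_support_add)

section \<open>The divergence of compactly supported fields\<close>

lemma divergence_eq:
  assumes "(\<phi> has_derivative D) (at x)"
  shows "divergence \<phi> x = (\<Sum>i\<in>UNIV. D (axis i 1) $ i)"
  unfolding divergence_def frechet_derivative_at[OF assms, symmetric] ..

lemma C1_compact_support_differentiable:
  "\<phi> \<in> C1_compact_support U \<Longrightarrow> x \<in> U \<Longrightarrow> \<phi> differentiable at x"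
  by (auto simp: C1_compact_support_def differentiable_def)

lemma divergence_add:
  assumes "\<phi> differentiable at x" "\<psi> differentiable at x"
  shows "divergence (\<lambda>x. \<phi> x + \<psi> x) x = divergence \<phi> x + divergence \<psi> x"
proof -
  obtain D E where "(\<phi> has_derivative D) (at x)" "(\<psi> has_derivative E) (at x)"
    using assms unfolding differentiable_def by blast
  then show ?thesis
    using divergence_eq[OF has_derivative_add] by (simp add: divergence_eq sum.distrib)
qed

lemma divergence_scaleR:
  assumes "\<phi> differentiable at x"
  shows "divergence (\<lambda>x. c *\<^sub>R \<phi> x) x = c * divergence \<phi> x"
proof -
  obtain D where "(\<phi> has_derivative D) (at x)"
    using assms unfolding differentiable_def by blast
  then show ?thesis
    using divergence_eq[OF has_derivative_scaleR_right]
    by (simp add: divergence_eq sum_distrib_left)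
qed

lemma continuous_divergence:
  fixes \<phi> :: "real^'n \<Rightarrow> real^'n"
  assumes "\<phi> \<in> C1_compact_support U"
  shows "continuous_on U (divergence \<phi>)"
proof -
  obtain D K where D: "\<And>x. x \<in> U \<Longrightarrow> (\<phi> has_derivative D x) (at x)" "\<And>e. continuous_on U (\<lambda>x. D x e)"
    using assms by (rule C1_compact_supportE) blast
  have "continuous_on U (\<lambda>x. \<Sum>i\<in>UNIV. D x (axis i 1) $ i)"
    by (intro continuous_intros D)
  then show ?thesis
    by (rule continuous_on_eq) (simp add: divergence_eq[OF D(1)])
qed

lemma divergence_eq_0:
  fixes \<phi> :: "real^'n \<Rightarrow> real^'n"
  assumes "open U" "compact K" "\<And>x. x \<in> U \<Longrightarrow> x \<notin> K \<Longrightarrow> \<phi> x = 0" "x \<in> U" "x \<notin> K"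
  shows "divergence \<phi> x = 0"
proof -
  have "(\<phi> has_derivative (\<lambda>t. 0)) (at x)"
    by (rule has_derivative_transform_within_open[of "\<lambda>x. 0" _ _ _ "U - K"])
       (use assms in \<open>auto intro!: open_Diff compact_imp_closed\<close>)
  then show ?thesis by (simp add: divergence_eq)
qed

lemma bounded_divergence:
  fixes \<phi> :: "real^'n \<Rightarrow> real^'n"
  assumes "\<phi> \<in> C1_compact_support U" "open U"
  obtains B where "B \<ge> 0" "\<And>x. x \<in> U \<Longrightarrow> \<bar>divergence \<phi> x\<bar> \<le> B"
proof -
  obtain K where K: "compact K" "K \<subseteq> U" "\<And>x. x \<in> U \<Longrightarrow> x \<notin> K \<Longrightarrow> \<phi> x = 0"
    using assms(1) by (rule C1_compact_supportE) blast
  have "compact (divergence \<phi> ` K)"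
    using continuous_on_subset[OF continuous_divergence[OF assms(1)] K(2)] K(1)
    by (rule compact_continuous_image)
  then obtain B where "\<And>x. x \<in> K \<Longrightarrow> \<bar>divergence \<phi> x\<bar> \<le> B" "0 < B"
    by (metis bounded_pos compact_imp_bounded imageI real_norm_def)
  then show ?thesis
    using divergence_eq_0[OF assms(2) K(1,3)] by (intro that[of B]) (force)+
qed

section \<open>The variation as a supremum of linear functionals\<close>

abbreviation "Q \<equiv> unit_square"

definition var_integral :: "(real^2 \<Rightarrow> real^2) \<Rightarrow> (real^2 \<Rightarrow> (real^2) \<times> (real^2)) \<Rightarrow> real"
  where "var_integral f \<phi> = (LINT x:Q|lborel. f x $ 1 * divergence (\<lambda>y. fst (\<phi> y)) x
                             + f x $ 2 * divergence (\<lambda>y. snd (\<phi> y)) x)"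

definition test_fields :: "(real^2 \<Rightarrow> (real^2) \<times> (real^2)) set"
  where "test_fields = {\<phi> \<in> C1_compact_support Q. \<forall>x\<in>Q. infnorm (\<phi> x) \<le> 1}"

lemma Var_eq: "Var f Q = (SUP \<phi>\<in>test_fields. ereal (var_integral f \<phi>))"
  unfolding Var_def test_fields_def var_integral_def ..

lemma open_Q: "open Q" and measurable_Q [measurable]: "Q \<in> sets borel"
  by (simp_all add: unit_square_def open_box)

lemma mem_Q: "x \<in> Q \<longleftrightarrow> 0 < x$1 \<and> x$1 < 1 \<and> 0 < x$2 \<and> x$2 < 1"
  by (auto simp: unit_square_def mem_box_cart forall_2)

lemma content_Q: "measure lborel Q = 1" "emeasure lborel Q = 1"
  "measure lebesgue Q = 1" "emeasure lebesgue Q = 1"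
proof -
  have "(1::real^2) \<bullet> b = 1" if "b \<in> Basis" for b
    using that by (auto simp: Basis_vec_def inner_axis)
  then show "measure lborel Q = 1" "emeasure lborel Q = 1"
      "measure lebesgue Q = 1" "emeasure lebesgue Q = 1"
    by (simp_all add: unit_square_def measure_lborel_box_eq emeasure_lborel_box_eq)
qed

lemma set_integrable_Q:
  fixes F :: "real^2 \<Rightarrow> real"
  assumes "continuous_on Q F" "\<And>x. x \<in> Q \<Longrightarrow> \<bar>F x\<bar> \<le> B"
  shows "set_integrable lborel Q F"
  unfolding set_integrable_def
proof (rule integrableI_bounded_set[where A = Q and B = B])
  show "(\<lambda>x. indicator Q x *\<^sub>R F x) \<in> borel_measurable lborel"
    using borel_measurable_continuous_on_indicator[OF _ assms(1)] by simp
qed (use assms in \<open>auto simp: content_Q\<close>)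

lemma component_bound_Q: "x \<in> Q \<Longrightarrow> \<bar>x $ 1\<bar> \<le> 1" "x \<in> Q \<Longrightarrow> \<bar>x $ 2\<bar> \<le> 1"
  by (auto simp: mem_Q)

lemma abs_mult_add_le: "\<bar>a * b + c * d\<bar> \<le> \<bar>a\<bar> * \<bar>b\<bar> + \<bar>c\<bar> * \<bar>d\<bar>" for a b c d :: real
  using abs_triangle_ineq[of "a * b" "c * d"] by (simp add: abs_mult)

lemma var_integrand_integrable:
  assumes f: "continuous_on Q f" "f ` Q \<subseteq> Q" and \<phi>: "\<phi> \<in> C1_compact_support Q"
  shows "set_integrable lborel Q (\<lambda>x. f x $ 1 * divergence (\<lambda>y. fst (\<phi> y)) x
                             + f x $ 2 * divergence (\<lambda>y. snd (\<phi> y)) x)"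
proof -
  note \<phi>12 = C1_compact_support_fst[OF \<phi>] C1_compact_support_snd[OF \<phi>]
  obtain B C where "B \<ge> 0" "\<And>x. x \<in> Q \<Longrightarrow> \<bar>divergence (\<lambda>y. fst (\<phi> y)) x\<bar> \<le> B"
    "C \<ge> 0" "\<And>x. x \<in> Q \<Longrightarrow> \<bar>divergence (\<lambda>y. snd (\<phi> y)) x\<bar> \<le> C"
    using bounded_divergence[OF \<phi>12(1) open_Q] bounded_divergence[OF \<phi>12(2) open_Q] by metis
  note BC = this
  show ?thesis
  proof (rule set_integrable_Q[where B = "1 * B + 1 * C"])
    fix x assume x: "x \<in> Q"
    then have fx: "f x \<in> Q" using f by auto
    have "\<bar>f x $ 1 * divergence (\<lambda>y. fst (\<phi> y)) x + f x $ 2 * divergence (\<lambda>y. snd (\<phi> y)) x\<bar>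
      \<le> \<bar>f x $ 1\<bar> * \<bar>divergence (\<lambda>y. fst (\<phi> y)) x\<bar> + \<bar>f x $ 2\<bar> * \<bar>divergence (\<lambda>y. snd (\<phi> y)) x\<bar>"
      by (rule abs_mult_add_le)
    also have "\<dots> \<le> 1 * B + 1 * C"
      using BC x component_bound_Q[OF fx] by (intro add_mono mult_mono) auto
    finally show "\<bar>f x $ 1 * divergence (\<lambda>y. fst (\<phi> y)) x + f x $ 2 * divergence (\<lambda>y. snd (\<phi> y)) x\<bar>
      \<le> 1 * B + 1 * C" .
  qed (intro continuous_intros f continuous_divergence \<phi>12)
qed

lemma var_integral_add:
  assumes f: "continuous_on Q f" "f ` Q \<subseteq> Q"
    and "\<phi> \<in> C1_compact_support Q" "\<psi> \<in> C1_compact_support Q"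
  shows "var_integral f (\<lambda>x. \<phi> x + \<psi> x) = var_integral f \<phi> + var_integral f \<psi>"
  unfolding var_integral_def
  by (subst set_integral_add(2)[symmetric], (rule var_integrand_integrable assms)+)
     (use assms in \<open>auto intro!: set_lebesgue_integral_cong
       simp: divergence_add C1_compact_support_differentiable[OF C1_compact_support_fst]
         C1_compact_support_differentiable[OF C1_compact_support_snd] algebra_simps\<close>)

lemma var_integral_scaleR:
  assumes "\<phi> \<in> C1_compact_support Q"
  shows "var_integral f (\<lambda>x. c *\<^sub>R \<phi> x) = c * var_integral f \<phi>"
  unfolding var_integral_def set_integral_mult_right[symmetric]
  using assms by (auto intro!: set_lebesgue_integral_cong
       simp: divergence_scaleR C1_compact_support_differentiable[OF C1_compact_support_fst]
         C1_compact_support_differentiable[OF C1_compact_support_snd] algebra_simps)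

lemma var_integral_0: "var_integral f (\<lambda>x. 0) = 0"
  using var_integral_scaleR[OF C1_compact_support_0, of f 0] by simp

lemma var_integral_sum:
  assumes f: "continuous_on Q f" "f ` Q \<subseteq> Q"
    and "finite I" "\<And>i. i \<in> I \<Longrightarrow> \<phi> i \<in> C1_compact_support Q"
  shows "var_integral f (\<lambda>x. \<Sum>i\<in>I. \<phi> i x) = (\<Sum>i\<in>I. var_integral f (\<phi> i))"
  using assms(3,4)
proof (induction I)
  case empty
  then show ?case by (simp add: var_integral_0)
next
  case (insert i I)
  have "var_integral f (\<lambda>x. \<phi> i x + (\<Sum>i\<in>I. \<phi> i x)) = var_integral f (\<phi> i) + var_integral f (\<lambda>x. \<Sum>i\<in>I. \<phi> i x)"
    using insert.prems by (intro var_integral_add f C1_compact_support_sum) auto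
  then show ?case using insert by simp
qed

lemma Var_ge_var_integral:
  assumes "\<phi> \<in> test_fields"
  shows "ereal (var_integral f \<phi>) \<le> Var f Q"
  unfolding Var_eq using assms by (rule SUP_upper)

lemma var_integral_le_Var:
  assumes "Var f Q = ereal v" "\<phi> \<in> C1_compact_support Q" "c > 0" "\<And>x. x \<in> Q \<Longrightarrow> infnorm (\<phi> x) \<le> c"
  shows "var_integral f \<phi> \<le> c * v"
proof -
  have "(\<lambda>x. (1/c) *\<^sub>R \<phi> x) \<in> test_fields"
    using assms by (simp add: test_fields_def C1_compact_support_scaleR infnorm_mul divide_simps)
  from Var_ge_var_integral[OF this, of f] show ?thesis
    using assms by (simp add: var_integral_scaleR field_simps)
qed

lemma Var_nonneg: "0 \<le> Var f Q"
proof -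
  have "(\<lambda>x. 0) \<in> test_fields"
    by (simp add: test_fields_def C1_compact_support_0 infnorm_0)
  from Var_ge_var_integral[OF this, of f] show ?thesis by (simp add: var_integral_0 flip: zero_ereal_def)
qed

text \<open>For a fixed field the pairing is Lipschitz in f for the supremum norm, with the bounds
  of the two divergences as constant, since Q has measure 1. Var is a supremum of such functionals,
  and this is the form in which its lower semicontinuity is used.\<close>

lemma var_integral_continuous:
  assumes f: "continuous_on Q f" "f ` Q \<subseteq> Q" and \<phi>: "\<phi> \<in> C1_compact_support Q" and "\<epsilon> > 0"
  obtains \<delta> where "\<delta> > 0" "\<And>g. continuous_on Q g \<Longrightarrow> g ` Q \<subseteq> Q \<Longrightarrow>
    (\<And>x. x \<in> Q \<Longrightarrow> norm (g x - f x) \<le> \<delta>) \<Longrightarrow> \<bar>var_integral g \<phi> - var_integral f \<phi>\<bar> \<le> \<epsilon>"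
proof -
  note \<phi>12 = C1_compact_support_fst[OF \<phi>] C1_compact_support_snd[OF \<phi>]
  obtain B C where "B \<ge> 0" "\<And>x. x \<in> Q \<Longrightarrow> \<bar>divergence (\<lambda>y. fst (\<phi> y)) x\<bar> \<le> B"
    "C \<ge> 0" "\<And>x. x \<in> Q \<Longrightarrow> \<bar>divergence (\<lambda>y. snd (\<phi> y)) x\<bar> \<le> C"
    using bounded_divergence[OF \<phi>12(1) open_Q] bounded_divergence[OF \<phi>12(2) open_Q] by metis
  note BC = this
  define \<delta> where "\<delta> = \<epsilon> / (B + C + 1)"
  have \<delta>: "\<delta> > 0" using BC \<open>\<epsilon> > 0\<close> by (simp add: \<delta>_def)
  show thesis
  proof (rule that[OF \<delta>])
    fix g assume g: "continuous_on Q g" "g ` Q \<subseteq> Q" "\<And>x. x \<in> Q \<Longrightarrow> norm (g x - f x) \<le> \<delta>"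
    let ?F = "\<lambda>f x. f x $ 1 * divergence (\<lambda>y. fst (\<phi> y)) x + f x $ 2 * divergence (\<lambda>y. snd (\<phi> y)) x"
    have int: "set_integrable lborel Q (?F g)" "set_integrable lborel Q (?F f)"
      by (intro var_integrand_integrable f g \<phi>)+
    have bd: "\<bar>?F g x - ?F f x\<bar> \<le> \<epsilon>" if x: "x \<in> Q" for x
    proof -
      have "?F g x - ?F f x = (g x - f x) $ 1 * divergence (\<lambda>y. fst (\<phi> y)) x
          + (g x - f x) $ 2 * divergence (\<lambda>y. snd (\<phi> y)) x"
        by (simp add: algebra_simps)
      also have "\<bar>\<dots>\<bar> \<le> \<bar>(g x - f x) $ 1\<bar> * \<bar>divergence (\<lambda>y. fst (\<phi> y)) x\<bar>
          + \<bar>(g x - f x) $ 2\<bar> * \<bar>divergence (\<lambda>y. snd (\<phi> y)) x\<bar>"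
        by (rule abs_mult_add_le)
      also have "\<dots> \<le> \<delta> * B + \<delta> * C"
        using BC x g(3)[OF x] component_le_norm_cart[of "g x - f x"] \<delta>
        by (intro add_mono mult_mono) (auto intro: order_trans)
      also have "\<dots> = \<epsilon> * ((B + C) / (B + C + 1))" by (simp add: \<delta>_def add_divide_distrib algebra_simps)
      also have "\<dots> \<le> \<epsilon> * 1" using BC \<open>\<epsilon> > 0\<close> by (intro mult_left_mono) auto
      finally show ?thesis by simp
    qed
    have "var_integral g \<phi> - var_integral f \<phi> = (LINT x:Q|lborel. ?F g x - ?F f x)"
      unfolding var_integral_def using int by (simp add: set_integral_diff)
    also have "\<bar>\<dots>\<bar> \<le> (LINT x:Q|lborel. \<epsilon>)"
      unfolding real_norm_def[symmetric]
    proof (rule order_trans[OF set_integral_norm_bound set_integral_mono])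
      show "set_integrable lborel Q (\<lambda>x. \<epsilon>)" by (rule set_integrable_Q[where B = \<epsilon>]) (use \<open>\<epsilon> > 0\<close> in auto)
      show "set_integrable lborel Q (\<lambda>x. ?F g x - ?F f x)"
        by (rule set_integral_diff(1)[OF int])
      then show "set_integrable lborel Q (\<lambda>x. norm (?F g x - ?F f x))"
        by (rule set_integrable_norm)
    qed (use bd in auto)
    also have "\<dots> = \<epsilon>" by (simp add: set_lebesgue_integral_def content_Q)
    finally show "\<bar>var_integral g \<phi> - var_integral f \<phi>\<bar> \<le> \<epsilon>" .
  qed
qed

section \<open>Shears of the square\<close>

abbreviation "Qc \<equiv> cbox (0::real^2) 1"

lemma mem_Qc: "x \<in> Qc \<longleftrightarrow> 0 \<le> x$1 \<and> x$1 \<le> 1 \<and> 0 \<le> x$2 \<and> x$2 \<le> 1"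
  by (auto simp: mem_box_cart forall_2)

lemma closure_Q: "closure Q = Qc"
proof -
  have "(1/2) *\<^sub>R 1 \<in> Q" by (simp add: mem_Q)
  then show ?thesis unfolding unit_square_def by (intro closure_box) auto
qed

lemma Q_subset_Qc: "Q \<subseteq> Qc"
  by (auto simp: mem_Q mem_Qc)

lemma has_derivative_component:
  assumes "(f has_real_derivative D) (at (w $ i))"
  shows "((\<lambda>w::real^'n. f (w $ i)) has_derivative (\<lambda>t. D * t $ i)) (at w)"
proof -
  have "((\<lambda>w::real^'n. w $ i) has_derivative (\<lambda>t. t $ i)) (at w)"
    by (rule bounded_linear_imp_has_derivative[OF bounded_linear_vec_nth])
  from has_derivative_compose[OF this assms[unfolded has_field_derivative_def]] show ?thesis .
qed

text \<open>The explicit map is \<open>H\<close>, the inverse of the map that is composed with f: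
  both the change of variables and the inverse of f o h then involve only \<open>H\<close>. Since p'
  > -1 and 0 \<le> \<tau> \<le> 1, every horizontal line is mapped strictly increasingly, on the
  whole plane.\<close>

locale shear =
  fixes p p' p'' \<tau> \<tau>' \<tau>'' :: "real \<Rightarrow> real"
  assumes p: "\<And>u. (p has_real_derivative p' u) (at u)" "\<And>u. (p' has_real_derivative p'' u) (at u)"
      "continuous_on UNIV p''" "p 0 = 0" "p 1 = 0" "\<And>u. -1 < p' u"
    and \<tau>: "\<And>v. (\<tau> has_real_derivative \<tau>' v) (at v)" "\<And>v. (\<tau>' has_real_derivative \<tau>'' v) (at v)"
      "continuous_on UNIV \<tau>''" "\<tau> 0 = 0" "\<tau> 1 = 0" "\<And>v. 0 \<le> \<tau> v" "\<And>v. \<tau> v \<le> 1"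
begin

definition H :: "real^2 \<Rightarrow> real^2"
  where "H w = w + (\<tau> (w$2) * p (w$1)) *\<^sub>R axis 1 1"

definition DH :: "real^2 \<Rightarrow> real^2 \<Rightarrow> real^2"
  where "DH w t = t + (\<tau> (w$2) * (p' (w$1) * t$1) + \<tau>' (w$2) * t$2 * p (w$1)) *\<^sub>R axis 1 1"

lemma H_nth: "H w $ 1 = w$1 + \<tau> (w$2) * p (w$1)" "H w $ 2 = w$2"
  by (simp_all add: H_def axis_def)

lemma has_derivative_H: "(H has_derivative DH w) (at w)"
  unfolding H_def[abs_def] DH_def[abs_def]
  by (intro has_derivative_add has_derivative_ident has_derivative_scaleR_left has_derivative_mult
      has_derivative_component p \<tau>)

lemma continuous_H: "continuous_on A H"
  by (meson continuous_at_imp_continuous_on has_derivative_H has_derivative_continuous)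

lemma det_pos: "0 < 1 + \<tau> v * p' u"
proof (cases "0 \<le> p' u")
  case True
  then show ?thesis using \<tau>(6)[of v] by (simp add: add_pos_nonneg)
next
  case False
  then have "1 * p' u \<le> \<tau> v * p' u" using \<tau>(7)[of v] by (intro mult_right_mono_neg) auto
  then show ?thesis using p(6)[of u] by simp
qed

lemma det_DH: "det (matrix (DH w)) = 1 + \<tau> (w$2) * p' (w$1)"
  by (simp add: det_2 matrix_def DH_def axis_def)

lemma strict_mono_row: "a < b \<Longrightarrow> a + \<tau> v * p a < b + \<tau> v * p b"
proof (rule DERIV_pos_imp_increasing[where f = "\<lambda>u. u + \<tau> v * p u"])
  fix u
  have "((\<lambda>u. u + \<tau> v * p u) has_real_derivative 1 + \<tau> v * p' u) (at u)"
    by (intro DERIV_add DERIV_ident DERIV_cmult p)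
  then show "\<exists>y. ((\<lambda>u. u + \<tau> v * p u) has_real_derivative y) (at u) \<and> 0 < y"
    using det_pos by blast
qed

lemma inj_H: "inj H"
proof (rule injI)
  fix x y assume "H x = H y"
  then have "x$2 = y$2" "x$1 + \<tau> (x$2) * p (x$1) = y$1 + \<tau> (x$2) * p (y$1)"
    by (metis H_nth)+
  then have "x$1 = y$1"
    using strict_mono_row[of "x$1" "y$1" "x$2"] strict_mono_row[of "y$1" "x$1" "x$2"]
    by (cases "x$1" "y$1" rule: linorder_cases) auto
  with \<open>x$2 = y$2\<close> show "x = y" by (simp add: vec_eq_iff forall_2)
qed

text \<open>On the vertical sides p vanishes, on the horizontal sides \<tau> does.\<close>

lemma H_eq_id: "w \<in> Qc \<Longrightarrow> w \<notin> Q \<Longrightarrow> H w = w"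
  using p \<tau> by (auto simp: H_def mem_Q mem_Qc less_le)

lemma H_in_Q:
  assumes "w \<in> Q"
  shows "H w \<in> Q"
  using assms strict_mono_row[of 0 "w$1" "w$2"] strict_mono_row[of "w$1" 1 "w$2"] p
  by (simp add: mem_Q H_nth)

lemma H_image_Q: "H ` Q = Q"
proof
  show "Q \<subseteq> H ` Q"
  proof
    fix x assume x: "x \<in> Q"
    let ?r = "\<lambda>u. u + \<tau> (x$2) * p u"
    have "isCont ?r u" for u
      by (intro continuous_intros DERIV_isCont[OF p(1)])
    then obtain u where u: "0 \<le> u" "u \<le> 1" "?r u = x$1"
      using IVT[of ?r 0 "x$1" 1] x p by (auto simp: mem_Q)
    have "u \<noteq> 0" "u \<noteq> 1" using u x p by (auto simp: mem_Q)
    define w :: "real^2" where "w = vector [u, x$2]"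
    have "H w = x" using u by (simp add: vec_eq_iff forall_2 H_nth w_def)
    moreover have "w \<in> Q" using u x \<open>u \<noteq> 0\<close> \<open>u \<noteq> 1\<close> by (simp add: mem_Q w_def)
    ultimately show "x \<in> H ` Q" by blast
  qed
qed (use H_in_Q in blast)

lemma H_image_Qc: "H ` Qc = Qc"
proof -
  have "Qc = Q \<union> (Qc - Q)" using Q_subset_Qc by blast
  moreover have "H ` (Qc - Q) = Qc - Q" using H_eq_id by force
  ultimately show ?thesis using H_image_Q by (metis image_Un)
qed

definition h :: "real^2 \<Rightarrow> real^2"
  where "h = inv H"

lemma h_H [simp]: "h (H w) = w"
  unfolding h_def using inj_H by (rule inv_f_f)

lemma homeomorphism_H_Qc: "homeomorphism Qc Qc H h"
proof -
  obtain g where g: "homeomorphism Qc Qc H g"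
    using homeomorphism_compact[OF compact_cbox continuous_H H_image_Qc] inj_H
    by (meson inj_on_subset subset_UNIV)
  then have "h y = g y" if "y \<in> Qc" for y
    by (metis h_H homeomorphism_apply2 that)
  then show ?thesis
    using g by (auto intro: homeomorphism_cong)
qed

lemma homeomorphism_H: "homeomorphism Q Q H h"
  by (rule homeomorphism_of_subsets[OF homeomorphism_H_Qc Q_subset_Qc _ H_image_Q]) (rule Q_subset_Qc)

lemma H_h: "y \<in> Qc \<Longrightarrow> H (h y) = y"
  using homeomorphism_H_Qc by (simp add: homeomorphism_def)

lemma h_in_Q: "y \<in> Q \<Longrightarrow> h y \<in> Q"
  using homeomorphism_H by (auto simp: homeomorphism_def)

lemma h_eq_id: "y \<in> Qc \<Longrightarrow> y \<notin> Q \<Longrightarrow> h y = y"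
  using H_eq_id h_H by metis

lemma norm_H_diff_le:
  assumes "\<And>u. 0 \<le> u \<Longrightarrow> u \<le> 1 \<Longrightarrow> \<bar>p u\<bar> \<le> \<delta>" "w \<in> Qc"
  shows "norm (H w - w) \<le> \<delta>"
proof -
  have "norm (H w - w) = \<tau> (w$2) * \<bar>p (w$1)\<bar>"
    using \<tau> by (simp add: H_def abs_mult)
  also have "\<dots> \<le> 1 * \<delta>"
    using assms \<tau> by (intro mult_mono) (auto simp: mem_Qc)
  finally show ?thesis by simp
qed

lemma norm_h_diff_le:
  assumes "\<And>u. 0 \<le> u \<Longrightarrow> u \<le> 1 \<Longrightarrow> \<bar>p u\<bar> \<le> \<delta>" "y \<in> Qc"
  shows "norm (h y - y) \<le> \<delta>"
  using norm_H_diff_le[OF assms(1), where w = "h y"] assms(2) homeomorphism_H_Qc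
  by (auto simp: H_h norm_minus_commute homeomorphism_def)

text \<open>The Piola transform: \<open>piola w\<close> is the adjugate of the Jacobian matrix of \<open>H\<close> at \<open>w\<close>.\<close>

definition piola :: "real^2 \<Rightarrow> real^2 \<Rightarrow> real^2"
  where "piola w q = q + (\<tau> (w$2) * p' (w$1) * q$2) *\<^sub>R axis 2 1 - (\<tau>' (w$2) * p (w$1) * q$2) *\<^sub>R axis 1 1"

lemma piola_nth:
  "piola w q $ 1 = q$1 - \<tau>' (w$2) * p (w$1) * q$2"
  "piola w q $ 2 = (1 + \<tau> (w$2) * p' (w$1)) * q$2"
  by (simp_all add: piola_def axis_def algebra_simps)

text \<open>The columns of an adjugate Jacobian matrix satisfy the Piola identity: the terms in
  which the matrix itself is differentiated cancel, here the two occurrences of \<tau>' p' times the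
  second component of the field. What remains is the determinant times the divergence at the image
  point. Second derivatives of p and \<tau> enter only through the C^1 claim.\<close>

lemma piola_transform:
  fixes \<phi> :: "real^2 \<Rightarrow> real^2"
  assumes "\<phi> \<in> C1_compact_support Q"
  shows "(\<lambda>w. piola w (\<phi> (H w))) \<in> C1_compact_support Q"
    and "w \<in> Q \<Longrightarrow> divergence (\<lambda>w. piola w (\<phi> (H w))) w = (1 + \<tau> (w$2) * p' (w$1)) * divergence \<phi> (H w)"
proof -
  obtain D K where D: "\<And>x. x \<in> Q \<Longrightarrow> (\<phi> has_derivative D x) (at x)" "\<And>e. continuous_on Q (\<lambda>x. D x e)"
    and K: "compact K" "K \<subseteq> Q" "\<And>x. x \<in> Q \<Longrightarrow> x \<notin> K \<Longrightarrow> \<phi> x = 0"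
    using assms by (rule C1_compact_supportE) blast
  define E where "E w t = D (H w) t + (\<tau> (w$2) * (p' (w$1) * t$1) + \<tau>' (w$2) * t$2 * p (w$1)) *\<^sub>R D (H w) (axis 1 1)" for w t
  have E: "((\<lambda>w. \<phi> (H w)) has_derivative E w) (at w)" if "w \<in> Q" for w
  proof -
    have DHw: "(\<phi> has_derivative D (H w)) (at (H w))" using D(1) H_in_Q that by blast
    interpret bounded_linear "D (H w)" by (rule has_derivative_bounded_linear[OF DHw])
    have "D (H w) (DH w t) = E w t" for t
      by (simp add: E_def DH_def add scaleR)
    then show ?thesis
      using has_derivative_compose[OF has_derivative_H DHw] by simp
  qed
  define G where "G w t = E w t
      + (\<tau> (w$2) * p' (w$1) * E w t $ 2 + (\<tau> (w$2) * (p'' (w$1) * t$1) + \<tau>' (w$2) * t$2 * p' (w$1)) * \<phi> (H w) $ 2) *\<^sub>R axis 2 1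
      - (\<tau>' (w$2) * p (w$1) * E w t $ 2 + (\<tau>' (w$2) * (p' (w$1) * t$1) + \<tau>'' (w$2) * t$2 * p (w$1)) * \<phi> (H w) $ 2) *\<^sub>R axis 1 1" for w t
  have G: "((\<lambda>w. piola w (\<phi> (H w))) has_derivative G w) (at w)" if "w \<in> Q" for w
    unfolding piola_def G_def[abs_def]
    by (intro has_derivative_add has_derivative_diff has_derivative_scaleR_left has_derivative_mult
        has_derivative_component p \<tau> E that bounded_linear.has_derivative[OF bounded_linear_vec_nth])
  have c: "continuous_on A (\<lambda>w. f (w $ i))" if "\<And>x. (f has_real_derivative f' x) (at x)" for f f' i and A :: "(real^2) set"
    by (rule continuous_on_compose2[of UNIV f]) (auto intro!: continuous_intros DERIV_continuous_on that)
  have c2: "continuous_on A (\<lambda>w. f (w $ i))" if "continuous_on UNIV f" for f :: "real \<Rightarrow> real" and i and A :: "(real^2) set"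
    by (rule continuous_on_compose2[of UNIV f]) (auto intro!: continuous_intros that)
  have cD: "continuous_on Q (\<lambda>w. D (H w) e)" for e
    using continuous_on_compose2[OF D(2) continuous_H] H_image_Q by blast
  have cE: "continuous_on Q (\<lambda>w. E w t)" for t
    unfolding E_def by (intro continuous_intros cD c[OF p(1)] c[OF p(2)] c[OF \<tau>(1)] c[OF \<tau>(2)])
  have c\<phi>: "continuous_on Q (\<lambda>w. \<phi> (H w))"
    by (intro continuous_at_imp_continuous_on ballI has_derivative_continuous[OF E])
  have cG: "continuous_on Q (\<lambda>w. G w t)" for t
    unfolding G_def
    by (intro continuous_intros cE c\<phi> c[OF p(1)] c[OF p(2)] c[OF \<tau>(1)] c[OF \<tau>(2)] c2[OF p(3)] c2[OF \<tau>(3)])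
  show "(\<lambda>w. piola w (\<phi> (H w))) \<in> C1_compact_support Q"
  proof (rule C1_compact_supportI[OF G cG])
    show "compact (h ` K)"
      using homeomorphism_H K by (meson compact_continuous_image continuous_on_subset homeomorphism_def)
    show "h ` K \<subseteq> Q" using K h_in_Q by blast
    fix w assume "w \<in> Q" "w \<notin> h ` K"
    then have "H w \<notin> K" by (metis h_H imageI)
    then show "piola w (\<phi> (H w)) = 0" using K(3)[of "H w"] H_in_Q[OF \<open>w \<in> Q\<close>] by (simp add: piola_def)
  qed
  show "divergence (\<lambda>w. piola w (\<phi> (H w))) w = (1 + \<tau> (w$2) * p' (w$1)) * divergence \<phi> (H w)" if "w \<in> Q"
    unfolding divergence_eq[OF G[OF that]] divergence_eq[OF D(1)[OF H_in_Q[OF that]]]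
    by (simp add: sum_2 G_def E_def axis_def algebra_simps)
qed

end

section \<open>Change of variables and composition with the inverse of a shear\<close>

lemma integral_change_of_variables_real:
  fixes F :: "real^'m::{finite,wellorder} \<Rightarrow> real" and g :: "real^'m::_ \<Rightarrow> real^'m::_"
  assumes "S \<in> sets lebesgue"
    and "\<And>x. x \<in> S \<Longrightarrow> (g has_derivative g' x) (at x within S)"
    and "inj_on g S" and F: "F absolutely_integrable_on (g ` S)"
  shows "integral S (\<lambda>x. \<bar>det (matrix (g' x))\<bar> * F (g x)) = integral (g ` S) F"
proof -
  \<comment> \<open>Real values are carried as vectors in real^1, where the vector-valued change of
    variables applies.\<close>
  define V :: "real^'m::_ \<Rightarrow> real^1" where "V x = vec (F x)" for x
  have "V absolutely_integrable_on (g ` S)" "integral (g ` S) V = vec (integral (g ` S) F)"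
    using F by (simp_all add: absolutely_integrable_on_1_iff integral_on_1_eq V_def)
  with has_absolute_integral_change_of_variables[OF assms(1-3), of V "vec (integral (g ` S) F)"]
  have "integral S (\<lambda>x. \<bar>det (matrix (g' x))\<bar> *\<^sub>R V (g x)) = vec (integral (g ` S) F)" by simp
  then show ?thesis by (simp add: integral_on_1_eq V_def vec_eq_iff)
qed

lemma set_integrable_lborel_imp_absolutely_integrable:
  fixes F :: "'a::euclidean_space \<Rightarrow> real"
  assumes "set_integrable lborel S F"
  shows "F absolutely_integrable_on S"
  using assms unfolding set_integrable_def
  by (subst integrable_completion) (auto dest: borel_measurable_integrable)

lemma inv_into_homeomorphism:
  assumes "homeomorphism S T f g" "y \<in> T"
  shows "inv_into S f y = g y"
  using assms by (metis homeomorphism_apply1 homeomorphism_apply2 homeomorphism_image2 imageI inj_on_def inv_into_f_eq)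

text \<open>The restriction makes the result extensional, as membership in \<open>BV_homeos\<close>
  demands.\<close>

definition precompose :: "(real^2 \<Rightarrow> real^2) \<Rightarrow> (real^2 \<Rightarrow> real^2) \<Rightarrow> real^2 \<Rightarrow> real^2"
  where "precompose f h = restrict (\<lambda>x. f (h x)) Q"

context shear
begin

definition pull :: "(real^2 \<Rightarrow> (real^2) \<times> (real^2)) \<Rightarrow> real^2 \<Rightarrow> (real^2) \<times> (real^2)"
  where "pull \<phi> w = (piola w (fst (\<phi> (H w))), piola w (snd (\<phi> (H w))))"

lemma pull_C1:
  assumes "\<phi> \<in> C1_compact_support Q"
  shows "pull \<phi> \<in> C1_compact_support Q"
  unfolding pull_def[abs_def]
  by (intro C1_compact_support_Pair piola_transform(1)[OF C1_compact_support_fst[OF assms]]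
      piola_transform(1)[OF C1_compact_support_snd[OF assms]])

lemma continuous_precompose:
  assumes "continuous_on Q f" "f ` Q \<subseteq> Q"
  shows "continuous_on Q (precompose f h)" "precompose f h ` Q \<subseteq> Q"
proof -
  have "continuous_on Q (\<lambda>x. f (h x))"
    using homeomorphism_H assms(1) h_in_Q
    by (intro continuous_on_compose2[OF assms(1)]) (auto simp: homeomorphism_def)
  then show "continuous_on Q (precompose f h)"
    by (rule continuous_on_eq) (simp add: precompose_def)
  show "precompose f h ` Q \<subseteq> Q"
    using assms(2) h_in_Q by (auto simp: precompose_def)
qed

text \<open>Substituting x = H w turns f (h x) into f w and produces the Jacobian determinant, which
  is positive and is exactly the factor in the divergence of the Piola transform. So f o h is tested
  by testing f with another field, and no derivative of f is needed.\<close>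

lemma var_integral_precompose:
  assumes f: "continuous_on Q f" "f ` Q \<subseteq> Q" and \<phi>: "\<phi> \<in> C1_compact_support Q"
  shows "var_integral (precompose f h) \<phi> = var_integral f (pull \<phi>)"
proof -
  let ?F = "\<lambda>f \<phi> x. f x $ 1 * divergence (\<lambda>y. fst (\<phi> y)) x + f x $ 2 * divergence (\<lambda>y. snd (\<phi> y)) x"
  note int1 = var_integrand_integrable[OF continuous_precompose[OF f] \<phi>]
  note int2 = var_integrand_integrable[OF f pull_C1[OF \<phi>]]
  note \<phi>12 = C1_compact_support_fst[OF \<phi>] C1_compact_support_snd[OF \<phi>]
  have "var_integral (precompose f h) \<phi> = integral (H ` Q) (?F (precompose f h) \<phi>)"
    unfolding var_integral_def H_image_Q by (rule set_borel_integral_eq_integral(2)[OF int1])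
  also have "\<dots> = integral Q (\<lambda>w. \<bar>det (matrix (DH w))\<bar> * ?F (precompose f h) \<phi> (H w))"
  proof (rule integral_change_of_variables_real[symmetric])
    show "inj_on H Q" using inj_H by (rule inj_on_subset) simp
    show "?F (precompose f h) \<phi> absolutely_integrable_on H ` Q"
      unfolding H_image_Q by (rule set_integrable_lborel_imp_absolutely_integrable[OF int1])
  qed (auto simp: has_derivative_H has_derivative_at_withinI)
  also have "\<dots> = integral Q (?F f (pull \<phi>))"
  proof (rule integral_cong)
    fix w assume w: "w \<in> Q"
    have "precompose f h (H w) = f w" using H_in_Q[OF w] by (simp add: precompose_def)
    moreover have "divergence (\<lambda>y. fst (pull \<phi> y)) w = (1 + \<tau> (w$2) * p' (w$1)) * divergence (\<lambda>y. fst (\<phi> y)) (H w)"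
      "divergence (\<lambda>y. snd (pull \<phi> y)) w = (1 + \<tau> (w$2) * p' (w$1)) * divergence (\<lambda>y. snd (\<phi> y)) (H w)"
      unfolding pull_def by (simp_all add: piola_transform(2)[OF \<phi>12(1) w] piola_transform(2)[OF \<phi>12(2) w])
    ultimately show "\<bar>det (matrix (DH w))\<bar> * ?F (precompose f h) \<phi> (H w) = ?F f (pull \<phi>) w"
      using det_pos[of "w$2" "w$1"] by (simp add: det_DH distrib_left mult.left_commute)
  qed
  also have "\<dots> = var_integral f (pull \<phi>)"
    unfolding var_integral_def by (rule set_borel_integral_eq_integral(2)[OF int2, symmetric])
  finally show ?thesis .
qed

lemma homeomorphism_precompose:
  assumes f: "homeomorphism Q Q f (inv_into Q f)"
  shows "homeomorphism Q Q (precompose f h) (inv_into Q (precompose f h))"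
    and "y \<in> Q \<Longrightarrow> inv_into Q (precompose f h) y = H (inv_into Q f y)"
proof -
  have "homeomorphism Q Q (f \<circ> h) (H \<circ> inv_into Q f)"
    using homeomorphism_compose[OF homeomorphism_symD[OF homeomorphism_H] f] .
  then have *: "homeomorphism Q Q (precompose f h) (H \<circ> inv_into Q f)"
    by (rule homeomorphism_cong) (auto simp: precompose_def)
  show eq: "inv_into Q (precompose f h) y = H (inv_into Q f y)" if "y \<in> Q" for y
    using inv_into_homeomorphism[OF * that] by simp
  show "homeomorphism Q Q (precompose f h) (inv_into Q (precompose f h))"
    using * by (rule homeomorphism_cong) (auto simp: eq)
qed

text \<open>As h fixes the boundary pointwise, the extension of f o h to the closed square is the
  extension of f composed with h.\<close>

lemma identity_on_boundary_precompose:
  assumes "identity_on_boundary f Q"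
  shows "identity_on_boundary (precompose f h) Q"
proof -
  let ?F = "\<lambda>x. if x \<in> Q then f x else x"
  have "continuous_on Qc (\<lambda>x. ?F (h x))"
    using assms homeomorphism_H_Qc
    by (intro continuous_on_compose2[of Qc ?F Qc h])
       (auto simp: identity_on_boundary_def closure_Q homeomorphism_def)
  then show ?thesis
    unfolding identity_on_boundary_def closure_Q
    by (rule continuous_on_eq) (use h_in_Q h_eq_id in \<open>auto simp: precompose_def\<close>)
qed

end

lemma infnorm_pair_le_iff:
  fixes \<phi> :: "(real^2) \<times> (real^2)"
  shows "infnorm \<phi> \<le> c \<longleftrightarrow>
    \<bar>fst \<phi> $ 1\<bar> \<le> c \<and> \<bar>fst \<phi> $ 2\<bar> \<le> c \<and> \<bar>snd \<phi> $ 1\<bar> \<le> c \<and> \<bar>snd \<phi> $ 2\<bar> \<le> c"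
proof -
  have B: "Basis = {axis 1 1, axis 2 1 :: real^2}"
    by (auto simp: Basis_vec_def UNIV_2)
  have "(\<lambda>b. \<bar>\<phi> \<bullet> b\<bar>) ` Basis = {\<bar>fst \<phi> $ 1\<bar>, \<bar>fst \<phi> $ 2\<bar>, \<bar>snd \<phi> $ 1\<bar>, \<bar>snd \<phi> $ 2\<bar>}"
    unfolding Basis_prod_def B by (cases \<phi>) (auto simp: inner_axis)
  then show ?thesis unfolding infnorm_Max by simp
qed

section \<open>Openness\<close>

definition concentrated :: "real \<Rightarrow> real \<Rightarrow> (real^2 \<Rightarrow> real^2) set"
  where "concentrated M \<delta> = {f \<in> BV_homeos M. \<exists>V K. open V \<and> V \<subseteq> Q \<and> compact K \<and> K \<subseteq> Q \<and>
    inv_into Q f ` K \<subseteq> V \<and> measure lebesgue V < \<delta> \<and> 1 - \<delta> < measure lebesgue K}"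

lemma BV_homeosD:
  assumes "f \<in> BV_homeos M"
  shows "homeomorphism Q Q f (inv_into Q f)" "continuous_on Q f" "f ` Q = Q"
    "continuous_on Q (inv_into Q f)" "inv_into Q f ` Q = Q" "identity_on_boundary f Q"
    "x \<in> Q \<Longrightarrow> inv_into Q f (f x) = x" "y \<in> Q \<Longrightarrow> f (inv_into Q f y) = y"
  using assms by (auto simp: BV_homeos_def homeomorphism_def)

text \<open>The same \<open>V\<close> and \<open>K\<close> serve for all g near f: the preimage of
  \<open>K\<close> under f is compact, so a whole r-neighbourhood of it lies in the open set
  \<open>V\<close>, and the inverses of f and g differ by less than r.\<close>

lemma openin_concentrated:
  "openin (Metric_space.mtopology (BV_homeos M) (dX M)) (concentrated M \<delta>)"
proof -
  interpret Metric_space "BV_homeos M" "dX M" by (rule Metric_space_BV_homeos)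
  have "\<exists>r>0. mball f r \<subseteq> concentrated M \<delta>" if f: "f \<in> concentrated M \<delta>" for f
  proof -
    from f obtain V K where fX: "f \<in> BV_homeos M" and VK: "open V" "V \<subseteq> Q" "compact K" "K \<subseteq> Q"
      "inv_into Q f ` K \<subseteq> V" "measure lebesgue V < \<delta>" "1 - \<delta> < measure lebesgue K"
      by (auto simp: concentrated_def)
    have "compact (inv_into Q f ` K)"
      using BV_homeosD(4)[OF fX] VK by (intro compact_continuous_image) (auto intro: continuous_on_subset)
    then obtain r where r: "r > 0" "(\<Union>x\<in>inv_into Q f ` K. ball x r) \<subseteq> V"
      using compact_subset_open_imp_ball_epsilon_subset VK(1,5) by metis
    have "g \<in> concentrated M \<delta>" if "g \<in> mball f r" for g
    proof -
      from that have gX: "g \<in> BV_homeos M" and d: "dX M f g < r" by auto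
      note im = BV_homeos_image[OF fX] BV_homeos_image[OF gX]
      have "inv_into Q g y \<in> V" if "y \<in> K" for y
      proof -
        have "norm (inv_into Q f y - inv_into Q g y) \<le> sup_norm_on Q (\<lambda>y. inv_into Q f y - inv_into Q g y)"
          using that VK im by (intro norm_le_sup_norm_on) auto
        also have "\<dots> \<le> dX M f g"
          using fX gX sup_norm_on_nonneg[OF im(1,3)] by (simp add: dX_def)
        finally have "inv_into Q g y \<in> ball (inv_into Q f y) r"
          using d by (simp add: dist_norm)
        then show ?thesis using r(2) that by blast
      qed
      then have "inv_into Q g ` K \<subseteq> V" by blast
      with gX VK show ?thesis unfolding concentrated_def by blast
    qed
    with r(1) show ?thesis by blast
  qed
  moreover have "concentrated M \<delta> \<subseteq> BV_homeos M" by (auto simp: concentrated_def)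
  ultimately show ?thesis unfolding openin_mtopology by blast
qed

text \<open>The set E of points lying in infinitely many V_n is null because the measures are
  summable. Almost every y lies in all but finitely many K_n, so its preimage lies in all but
  finitely many V_n and in particular in E.\<close>

lemma null_to_full_if_concentrated:
  assumes "\<And>n::nat. f \<in> concentrated M ((1/2)^n)"
  shows "f \<in> null_to_full M"
proof -
  have fX: "f \<in> BV_homeos M" using assms[of 0] by (simp add: concentrated_def)
  have "\<forall>n. \<exists>V K. open V \<and> V \<subseteq> Q \<and> compact K \<and> K \<subseteq> Q \<and>
    inv_into Q f ` K \<subseteq> V \<and> measure lebesgue V < (1/2)^n \<and> 1 - (1/2)^n < measure lebesgue K"
    using assms by (simp add: concentrated_def)
  then obtain V K where VK: "\<And>n. open (V n)" "\<And>n. V n \<subseteq> Q" "\<And>n. compact (K n)" "\<And>n. K n \<subseteq> Q"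
    "\<And>n. inv_into Q f ` K n \<subseteq> V n" "\<And>n::nat. measure lebesgue (V n) < (1/2)^n"
    "\<And>n. 1 - (1/2)^n < measure lebesgue (K n)"
    by metis
  have Qm: "Q \<in> sets lebesgue" using measurable_Q by simp
  have fin: "emeasure lebesgue A < \<infinity>" if "A \<subseteq> Q" for A
    using emeasure_mono[OF that Qm] content_Q(4) by (simp add: order_le_less_trans)
  have geo: "summable (\<lambda>n. (1/2)^n :: real)" by (intro summable_geometric) simp
  have Vm: "V n \<in> sets borel" and Km: "K n \<in> sets borel" for n
    using VK(1,3) by (auto intro: borel_open borel_closed compact_imp_closed)
  have nullE: "limsup V \<in> null_sets lebesgue"
  proof (rule borel_cantelli_limsup1)
    show "summable (\<lambda>n. measure lebesgue (V n))"
      by (rule summable_comparison_test_ev[OF always_eventually geo])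
         (use VK(6) in \<open>auto intro: less_imp_le\<close>)
    show "emeasure lebesgue (V n) < \<infinity>" for n by (rule fin[OF VK(2)])
  qed (use Vm in auto)
  have nullC: "limsup (\<lambda>n. Q - K n) \<in> null_sets lebesgue"
  proof (rule borel_cantelli_limsup1)
    have "measure lebesgue (Q - K n) = 1 - measure lebesgue (K n)" for n
      using VK(4)[of n] Km[of n] Qm fin[of Q]
      by (subst measure_Diff) (auto simp: content_Q less_top)
    then have "norm (measure lebesgue (Q - K n)) \<le> (1/2)^n" for n
      using VK(7)[of n] by (metis abs_of_nonneg diff_less_eq less_diff_eq less_eq_real_def
          measure_nonneg real_norm_def add.commute)
    then show "summable (\<lambda>n. measure lebesgue (Q - K n))"
      by (intro summable_comparison_test_ev[OF always_eventually geo] allI)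
    show "emeasure lebesgue (Q - K n) < \<infinity>" for n by (rule fin) blast
  qed (use Km Qm in auto)
  define E where "E = limsup V"
  have E: "E \<in> sets borel" "E \<subseteq> Q" "emeasure lebesgue E = 0"
  proof -
    show "E \<in> sets borel" unfolding E_def limsup_INF_SUP using Vm by measurable
    show "E \<subseteq> Q" using VK(2) unfolding E_def limsup_INF_SUP by fastforce
    show "emeasure lebesgue E = 0" using nullE by (simp add: E_def null_setsD1)
  qed
  have sub: "Q - limsup (\<lambda>n. Q - K n) \<subseteq> f ` E"
  proof
    fix y assume y: "y \<in> Q - limsup (\<lambda>n. Q - K n)"
    then obtain n where "\<forall>i\<ge>n. y \<in> K i" by (auto simp: limsup_INF_SUP)
    then have "\<forall>i\<ge>n. inv_into Q f y \<in> V i" using VK(5) by blast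
    then have "\<forall>i. \<exists>j\<ge>i. inv_into Q f y \<in> V j" by (metis nle_le)
    then have "inv_into Q f y \<in> E" by (auto simp: E_def limsup_INF_SUP)
    moreover have "f (inv_into Q f y) = y" using y BV_homeosD(8)[OF fX] by blast
    ultimately show "y \<in> f ` E" by (metis imageI)
  qed
  have fE: "f ` E \<subseteq> Q" using E(2) BV_homeosD(3)[OF fX] by blast
  have "emeasure lebesgue (f ` E) = 1"
  proof -
    \<comment> \<open>The complement of the image lies in a null set, so completeness of Lebesgue
      measure settles both the measurability of the image and its measure.\<close>
    have "Q - f ` E \<subseteq> limsup (\<lambda>n. Q - K n)" using sub by blast
    then have "Q - f ` E \<in> null_sets lebesgue"
      using nullC by (rule null_sets_completion_subset)
    then have "emeasure lebesgue (Q - (Q - f ` E)) = emeasure lebesgue Q"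
      using Qm by (rule emeasure_Diff_null_set)
    then show ?thesis using fE by (simp add: content_Q double_diff)
  qed
  with fX E show ?thesis by (auto simp: null_to_full_def)
qed

lemma residual_if_dense:
  assumes dense: "\<And>f \<epsilon> \<delta>. f \<in> BV_homeos M \<Longrightarrow> \<epsilon> > 0 \<Longrightarrow> \<delta> > 0 \<Longrightarrow> \<exists>g\<in>concentrated M \<delta>. dX M f g < \<epsilon>"
  shows "residual_in (Metric_space.mtopology (BV_homeos M) (dX M)) (null_to_full M)"
proof -
  interpret Metric_space "BV_homeos M" "dX M" by (rule Metric_space_BV_homeos)
  let ?G = "range (\<lambda>n::nat. concentrated M ((1/2)^n))"
  show ?thesis
    unfolding residual_in_def topspace_mtopology
  proof (intro conjI exI[of _ ?G] ballI)
    show "null_to_full M \<subseteq> BV_homeos M" by (auto simp: null_to_full_def)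
    show "countable ?G" by simp
    show "openin mtopology U" if "U \<in> ?G" for U
      using that openin_concentrated by blast
    show "mtopology closure_of U = BV_homeos M" if "U \<in> ?G" for U
    proof -
      from that obtain n :: nat where U: "U = concentrated M ((1/2)^n)" by blast
      show ?thesis
        unfolding metric_closure_of
        using dense[of _ _ "(1/2)^n"] by (fastforce simp: U concentrated_def)
    qed
    show "BV_homeos M \<inter> \<Inter>?G \<subseteq> null_to_full M"
      using null_to_full_if_concentrated by blast
  qed
qed

section \<open>Density\<close>

text \<open>Integrate the sum of the indicators, which is the number of sets containing the point
  and hence at most c on B and 0 elsewhere.\<close>

lemma sum_measure_le_overlap:
  assumes "finite I" "\<And>i. i \<in> I \<Longrightarrow> A i \<in> sets M" "\<And>i. i \<in> I \<Longrightarrow> A i \<subseteq> B"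
    and B: "B \<in> sets M" "emeasure M B < \<infinity>" and c: "\<And>x. x \<in> B \<Longrightarrow> card {i\<in>I. x \<in> A i} \<le> c"
  shows "(\<Sum>i\<in>I. measure M (A i)) \<le> real c * measure M B"
proof -
  have fin: "emeasure M (A i) < \<infinity>" if "i \<in> I" for i
    using emeasure_mono[OF assms(3)[OF that] B(1)] B(2) by (simp add: order_le_less_trans)
  have "(\<Sum>i\<in>I. measure M (A i)) = (\<Sum>i\<in>I. integral\<^sup>L M (indicator (A i)))"
    using assms by (intro sum.cong refl) (simp add: sets.sets_into_space Int_absorb2)
  also have "\<dots> = (\<integral>x. (\<Sum>i\<in>I. indicator (A i) x) \<partial>M)"
    using assms fin by (intro Bochner_Integration.integral_sum[symmetric]) simp
  also have "\<dots> \<le> (\<integral>x. real c * indicator B x \<partial>M)"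
  proof (rule integral_mono)
    show "integrable M (\<lambda>x. \<Sum>i\<in>I. indicator (A i) x :: real)"
      using assms fin by (intro Bochner_Integration.integrable_sum) simp
    show "integrable M (\<lambda>x. real c * indicator B x)" using B by simp
    fix x
    have "(\<Sum>i\<in>I. indicator (A i) x) = real (card {i\<in>I. x \<in> A i})"
      using assms(1) by (simp add: indicator_def sum.If_cases Int_def)
    moreover have "x \<notin> B \<Longrightarrow> {i\<in>I. x \<in> A i} = {}" using assms(3) by blast
    ultimately show "(\<Sum>i\<in>I. indicator (A i) x) \<le> real c * indicator B x"
      using c[of x] by (cases "x \<in> B") auto
  qed
  also have "\<dots> = real c * measure M B"
    using B by (simp add: sets.sets_into_space Int_absorb2)
  finally show ?thesis .
qed

lemma homeomorphism_open_image_Q: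
  assumes "homeomorphism Q Q f g" "open S" "S \<subseteq> Q"
  shows "open (f ` S)"
proof -
  have "f ` S = Q \<inter> g -` S"
  proof (intro equalityI subsetI)
    fix y assume "y \<in> f ` S"
    then obtain x where "x \<in> S" "y = f x" by blast
    then show "y \<in> Q \<inter> g -` S"
      using assms(3) homeomorphism_apply1[OF assms(1), of x] homeomorphism_image1[OF assms(1)] by auto
  next
    fix y assume "y \<in> Q \<inter> g -` S"
    then show "y \<in> f ` S"
      using homeomorphism_apply2[OF assms(1), of y] by (metis IntD1 IntD2 imageI vimageD)
  qed
  then show ?thesis
    using assms open_Q by (simp add: homeomorphism_def continuous_open_preimage)
qed

lemma cutoff_exists:
  fixes \<beta> :: real
  assumes "0 < \<beta>"
  obtains \<tau> \<tau>' \<tau>'' :: "real \<Rightarrow> real" and C :: real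
  where "\<And>v. (\<tau> has_real_derivative \<tau>' v) (at v)" "\<And>v. (\<tau>' has_real_derivative \<tau>'' v) (at v)"
    "continuous_on UNIV \<tau>''" "\<tau> 0 = 0" "\<tau> 1 = 0" "\<And>v. 0 \<le> \<tau> v" "\<And>v. \<tau> v \<le> 1"
    "\<And>v. \<beta> \<le> v \<Longrightarrow> v \<le> 1 - \<beta> \<Longrightarrow> \<tau> v = 1" "0 \<le> C" "\<And>v. 0 \<le> v \<Longrightarrow> v \<le> 1 \<Longrightarrow> \<bar>\<tau>' v\<bar> \<le> C"
proof -
  \<comment> \<open>The step \<open>spline 3\<close> reaches 1 at argument 3, so with this scaling
    both factors of \<tau> are 1 at distance at least \<beta> from the ends.\<close>
  define a where "a = 3 / \<beta>"
  define \<tau> where "\<tau> v = spline 3 (a * v) * spline 3 (a * (1 - v))" for v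
  define \<tau>' where "\<tau>' v = a * (spline 2 (a * v) * spline 3 (a * (1 - v)) - spline 3 (a * v) * spline 2 (a * (1 - v)))" for v
  define \<tau>'' where "\<tau>'' v = a\<^sup>2 * (spline 1 (a * v) * spline 3 (a * (1 - v))
    - 2 * (spline 2 (a * v) * spline 2 (a * (1 - v))) + spline 3 (a * v) * spline 1 (a * (1 - v)))" for v
  have d1: "((\<lambda>v. f (a * v)) has_real_derivative f' (a * v) * a) (at v)"
    and d2: "((\<lambda>v. f (a * (1 - v))) has_real_derivative f' (a * (1 - v)) * - a) (at v)"
    if "\<And>x. (f has_real_derivative f' x) (at x)" for f f' :: "real \<Rightarrow> real" and v
    by (rule DERIV_chain2[OF that], force intro!: derivative_eq_intros)+
  have \<tau>: "(\<tau> has_real_derivative \<tau>' v) (at v)" for v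
    unfolding \<tau>_def[abs_def]
    by (rule DERIV_cong[OF DERIV_mult[OF d1[OF DERIV_spline_3] d2[OF DERIV_spline_3]]])
       (simp add: \<tau>'_def algebra_simps)
  have \<tau>': "(\<tau>' has_real_derivative \<tau>'' v) (at v)" for v
    unfolding \<tau>'_def[abs_def]
    by (rule DERIV_cong[OF DERIV_cmult[OF DERIV_diff[OF DERIV_mult[OF d1[OF DERIV_spline_2] d2[OF DERIV_spline_3]]
          DERIV_mult[OF d1[OF DERIV_spline_3] d2[OF DERIV_spline_2]]]]])
       (simp add: \<tau>''_def algebra_simps power2_eq_square)
  have "continuous_on {0..1} \<tau>'"
    by (rule DERIV_continuous_on) (rule has_field_derivative_at_within[OF \<tau>'])
  then have "bounded (\<tau>' ` {0..1})"
    by (intro compact_imp_bounded compact_continuous_image) auto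
  then obtain C where C: "0 < C" "\<And>v. v \<in> {0..1} \<Longrightarrow> \<bar>\<tau>' v\<bar> \<le> C"
    by (metis bounded_pos imageI real_norm_def)
  show ?thesis
  proof (rule that[of \<tau> \<tau>' \<tau>'' C])
    show "continuous_on UNIV \<tau>''"
      unfolding \<tau>''_def[abs_def]
      by (intro continuous_intros continuous_on_compose2[OF continuous_spline[of UNIV]]) auto
    show "\<tau> 0 = 0" "\<tau> 1 = 0" by (simp_all add: \<tau>_def spline_left)
    show "0 \<le> \<tau> v" "\<tau> v \<le> 1" for v
      using spline_3_bounds by (simp_all add: \<tau>_def mult_le_one)
    show "\<tau> v = 1" if "\<beta> \<le> v" "v \<le> 1 - \<beta>" for v
      using that assms by (simp add: \<tau>_def spline_3_right a_def field_simps)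
  qed (use \<tau> \<tau>' C in auto)
qed

text \<open>Provides the strip on which a cutoff equals 1: a uniform ball around each point of K
  stays in Q, and moving up or down by half its radius bounds the height away from 0 and 1.\<close>

lemma compact_in_Q_strip:
  assumes "compact K" "K \<subseteq> Q"
  obtains \<beta> where "0 < \<beta>" "\<And>x. x \<in> K \<Longrightarrow> \<beta> < x$2" "\<And>x. x \<in> K \<Longrightarrow> x$2 < 1 - \<beta>"
proof -
  obtain e where e: "e > 0" "(\<Union>x\<in>K. ball x e) \<subseteq> Q"
    using compact_subset_open_imp_ball_epsilon_subset[OF assms(1) open_Q assms(2)] by metis
  have "x + c *\<^sub>R axis 2 1 \<in> Q" if "x \<in> K" "\<bar>c\<bar> < e" for x c
    using that e(2) by (force simp: dist_norm subset_iff)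
  from this[of _ "e/2"] this[of _ "- (e/2)"] e(1)
  have "e / 2 < x $ 2 \<and> x $ 2 < 1 - e / 2" if "x \<in> K" for x
    using that by (force simp: mem_Q)
  then show ?thesis using e(1) by (intro that[of "e/2"]) auto
qed

lemma compact_subset_almost_full:
  assumes "\<delta> > 0"
  obtains K where "compact K" "K \<subseteq> Q" "1 - \<delta> < measure lebesgue K"
proof -
  have Qm: "Q \<in> sets lebesgue" using measurable_Q by simp
  obtain K where K: "closed K" "K \<subseteq> Q" "Q - K \<in> lmeasurable" "emeasure lebesgue (Q - K) < ennreal \<delta>"
    using sets_lebesgue_inner_closed[OF Qm \<open>\<delta> > 0\<close>] by metis
  have cK: "compact K"
    using K bounded_unit_square by (meson bounded_subset compact_eq_bounded_closed)
  have "measure lebesgue (Q - K) = 1 - measure lebesgue K"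
    using K cK Qm by (subst measure_Diff) (auto simp: content_Q)
  moreover have "measure lebesgue (Q - K) < \<delta>"
    using K assms by (simp add: emeasure_eq_measure2 ennreal_less_iff)
  ultimately show ?thesis using that cK K by auto
qed

text \<open>The variations of the maps \<open>f \<circ> h\<^sub>k\<close> are bounded on average: the pulled-back test fields have
  entries at most $1 + \<tau> p'_k + |\<tau>' p_k|$, and the $p'_k$ almost cancel in the mean.\<close>

lemma sum_var_integral_precompose_le:
  fixes p p' p'' :: "nat \<Rightarrow> real \<Rightarrow> real"
  assumes S: "\<And>k. k < N \<Longrightarrow> shear (p k) (p' k) (p'' k) \<tau> \<tau>' \<tau>''"
    and f: "continuous_on Q f" "f ` Q \<subseteq> Q" "Var f Q = ereal v" and N: "N \<ge> 1"
    and pb: "\<And>k u. k < N \<Longrightarrow> 0 \<le> u \<Longrightarrow> u \<le> 1 \<Longrightarrow> \<bar>p k u\<bar> \<le> \<delta>" and \<delta>: "0 \<le> \<delta>"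
    and C: "0 \<le> C" "\<And>v. 0 \<le> v \<Longrightarrow> v \<le> 1 \<Longrightarrow> \<bar>\<tau>' v\<bar> \<le> C"
    and sum: "\<And>u. (\<Sum>k<N. 1 + p' k u) \<le> real N + 2"
    and \<phi>: "\<And>k. k < N \<Longrightarrow> \<phi> k \<in> test_fields"
  shows "(\<Sum>k<N. var_integral (precompose f (shear.h (p k) \<tau>)) (\<phi> k)) \<le> (real N + 2 + real N * (C * \<delta>)) * v"
proof -
  let ?\<psi> = "\<lambda>k. shear.pull (p k) (p' k) \<tau> \<tau>' (\<phi> k)"
  let ?c = "real N + 2 + real N * (C * \<delta>)"
  have C1: "\<phi> k \<in> C1_compact_support Q" if "k < N" for k using \<phi>[OF that] by (simp add: test_fields_def)
  have \<psi>C1: "?\<psi> k \<in> C1_compact_support Q" if "k < N" for k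
    using shear.pull_C1[OF S[OF that] C1[OF that]] .
  have "(\<Sum>k<N. var_integral (precompose f (shear.h (p k) \<tau>)) (\<phi> k)) = (\<Sum>k<N. var_integral f (?\<psi> k))"
    by (intro sum.cong refl shear.var_integral_precompose[OF S] f C1) auto
  \<comment> \<open>Linearity merges the N pulled-back fields, each built from its own \<phi> k,
    into one field that is tested against f.\<close>
  also have "\<dots> = var_integral f (\<lambda>w. \<Sum>k<N. ?\<psi> k w)"
    by (intro var_integral_sum[symmetric] f \<psi>C1) auto
  also have "\<dots> \<le> ?c * v"
  proof (rule var_integral_le_Var[OF f(3)])
    show "(\<lambda>w. \<Sum>k<N. ?\<psi> k w) \<in> C1_compact_support Q" by (intro C1_compact_support_sum \<psi>C1) auto
    have "0 \<le> real N * (C * \<delta>)" using C(1) \<delta> by simp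
    then show "0 < ?c" by linarith
    fix w assume w: "w \<in> Q"
    have q: "\<bar>q $ 1\<bar> \<le> 1 \<Longrightarrow> \<bar>q $ 2\<bar> \<le> 1 \<Longrightarrow> \<bar>shear.piola (p k) (p' k) \<tau> \<tau>' w q $ 1\<bar> \<le> 1 + C * \<delta>"
      "\<bar>q $ 1\<bar> \<le> 1 \<Longrightarrow> \<bar>q $ 2\<bar> \<le> 1 \<Longrightarrow> \<bar>shear.piola (p k) (p' k) \<tau> \<tau>' w q $ 2\<bar> \<le> 1 + \<tau> (w$2) * p' k (w$1)"
      if k: "k < N" for k and q :: "real^2"
    proof -
      assume q: "\<bar>q $ 1\<bar> \<le> 1" "\<bar>q $ 2\<bar> \<le> 1"
      have "\<bar>\<tau>' (w$2)\<bar> * \<bar>p k (w$1)\<bar> * \<bar>q $ 2\<bar> \<le> C * \<delta> * 1"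
        using q w C k \<delta> by (intro mult_mono pb) (auto simp: mem_Q)
      then have "\<bar>\<tau>' (w$2) * p k (w$1) * q $ 2\<bar> \<le> C * \<delta>" by (simp add: abs_mult)
      then show "\<bar>shear.piola (p k) (p' k) \<tau> \<tau>' w q $ 1\<bar> \<le> 1 + C * \<delta>"
        using q(1) unfolding shear.piola_nth[OF S[OF k]] by linarith
      have "(1 + \<tau> (w$2) * p' k (w$1)) * \<bar>q $ 2\<bar> \<le> (1 + \<tau> (w$2) * p' k (w$1)) * 1"
        using q shear.det_pos[OF S[OF k], of "w$2" "w$1"] by (intro mult_left_mono) auto
      then show "\<bar>shear.piola (p k) (p' k) \<tau> \<tau>' w q $ 2\<bar> \<le> 1 + \<tau> (w$2) * p' k (w$1)"
        using shear.det_pos[OF S[OF k], of "w$2" "w$1"]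
        unfolding shear.piola_nth[OF S[OF k]] by (simp add: abs_mult)
    qed
    have n: "infnorm (\<phi> k (shear.H (p k) \<tau> w)) \<le> 1" if "k < N" for k
      using \<phi>[OF that] shear.H_in_Q[OF S[OF that] w] by (simp add: test_fields_def)
    have b1: "(\<Sum>k<N. 1 + C * \<delta>) \<le> ?c" by (simp add: algebra_simps)
    \<comment> \<open>Multiplication by \<tau> in [0,1] moves the sum of the p'_k towards 0, so the
      upper bound 2 survives even where that sum is negative.\<close>
    have b2: "(\<Sum>k<N. 1 + \<tau> (w$2) * p' k (w$1)) \<le> ?c"
    proof -
      have "(\<Sum>k<N. p' k (w$1)) \<le> 2" using sum[of "w$1"] by (simp add: sum.distrib)
      moreover have "0 \<le> \<tau> (w$2)" "\<tau> (w$2) \<le> 1"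
        using S[of 0] N by (auto simp: shear_def)
      ultimately have "\<tau> (w$2) * (\<Sum>k<N. p' k (w$1)) \<le> 2"
        using mult_left_le_one_le[of "\<Sum>k<N. p' k (w$1)" "\<tau> (w$2)"]
          mult_nonneg_nonpos[of "\<tau> (w$2)" "\<Sum>k<N. p' k (w$1)"]
        by (cases "0 \<le> (\<Sum>k<N. p' k (w$1))") auto
      then show ?thesis using \<open>0 \<le> real N * (C * \<delta>)\<close> by (simp add: sum.distrib sum_distrib_left)
    qed
    have bound: "\<bar>\<Sum>k<N. a k\<bar> \<le> ?c" if "\<And>k. k < N \<Longrightarrow> \<bar>a k\<bar> \<le> b k" "(\<Sum>k<N. b k) \<le> ?c" for a b :: "nat \<Rightarrow> real"
    proof -
      have "\<bar>\<Sum>k<N. a k\<bar> \<le> (\<Sum>k<N. b k)"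
        using that(1) by (intro order_trans[OF sum_abs] sum_mono) auto
      with that(2) show ?thesis by linarith
    qed
    \<comment> \<open>The components are summed separately: first components are of size about 1
      each, second ones of size 1 + \<tau> p'_k. A triangle inequality for whole fields would add up
      the maxima of the two and lose the cancellation.\<close>
    show "infnorm (\<Sum>k<N. ?\<psi> k w) \<le> ?c"
      unfolding infnorm_pair_le_iff fst_sum snd_sum sum_component
    proof (intro conjI)
      show "\<bar>\<Sum>k<N. fst (?\<psi> k w) $ 1\<bar> \<le> ?c" "\<bar>\<Sum>k<N. snd (?\<psi> k w) $ 1\<bar> \<le> ?c"
        by (rule bound[OF _ b1], use n in \<open>simp add: shear.pull_def[OF S] infnorm_pair_le_iff q\<close>)+
      show "\<bar>\<Sum>k<N. fst (?\<psi> k w) $ 2\<bar> \<le> ?c" "\<bar>\<Sum>k<N. snd (?\<psi> k w) $ 2\<bar> \<le> ?c"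
        by (rule bound[OF _ b2], use n in \<open>simp add: shear.pull_def[OF S] infnorm_pair_le_iff q\<close>)+
    qed
  qed
  finally show ?thesis .
qed

text \<open>The extension by the identity is continuous on the compact closed square.\<close>

lemma uniformly_continuous_BV_homeos:
  assumes "f \<in> BV_homeos M" "\<epsilon> > 0"
  obtains \<delta> where "\<delta> > 0" "\<And>x y. x \<in> Q \<Longrightarrow> y \<in> Q \<Longrightarrow> norm (y - x) < \<delta> \<Longrightarrow> norm (f y - f x) < \<epsilon>"
proof -
  have "uniformly_continuous_on Qc (\<lambda>x. if x \<in> Q then f x else x)"
    using BV_homeosD(6)[OF assms(1)]
    by (intro compact_uniformly_continuous) (auto simp: identity_on_boundary_def closure_Q)
  then obtain \<delta> where "\<delta> > 0" and \<delta>: "\<And>x y. x \<in> Qc \<Longrightarrow> y \<in> Qc \<Longrightarrow> dist y x < \<delta> \<Longrightarrow>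
      dist (if y \<in> Q then f y else y) (if x \<in> Q then f x else x) < \<epsilon>"
    using \<open>\<epsilon> > 0\<close> unfolding uniformly_continuous_on_def by metis
  have "norm (f y - f x) < \<epsilon>" if "x \<in> Q" "y \<in> Q" "norm (y - x) < \<delta>" for x y
    using \<delta>[of x y] that Q_subset_Qc by (auto simp: dist_norm)
  with \<open>\<delta> > 0\<close> show ?thesis by (rule that)
qed

lemma BV_homeos_Var:
  assumes "f \<in> BV_homeos M"
  obtains v where "Var f Q = ereal v" "0 \<le> v" "v < M"
proof -
  have "Var f Q < ereal M" using assms by (simp add: BV_homeos_def)
  then show ?thesis
    using Var_nonneg[of f] that by (cases "Var f Q") auto
qed

text \<open>Controls the third term of \<open>dX\<close>; the conclusion u < M also keeps a map with
  variation u inside the space.\<close>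

lemma inverse_gap_continuous:
  fixes v M \<epsilon> :: real
  assumes "v < M" "\<epsilon> > 0"
  obtains \<gamma> where "\<gamma> > 0" "\<And>u. \<bar>u - v\<bar> < \<gamma> \<Longrightarrow> u < M \<and> \<bar>1 / (M - v) - 1 / (M - u)\<bar> < \<epsilon>"
proof -
  have "((\<lambda>u. 1 / (M - u)) \<longlongrightarrow> 1 / (M - v)) (at v)"
    using assms by (intro tendsto_intros) auto
  then have "\<forall>\<^sub>F u in at v. dist (1 / (M - u)) (1 / (M - v)) < \<epsilon>"
    using \<open>\<epsilon> > 0\<close> by (rule tendstoD)
  then obtain d where d: "d > 0" "\<And>u. u \<noteq> v \<Longrightarrow> dist u v < d \<Longrightarrow> dist (1 / (M - u)) (1 / (M - v)) < \<epsilon>"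
    unfolding eventually_at by auto
  show ?thesis
  proof (rule that[of "min d (M - v)"])
    fix u assume u: "\<bar>u - v\<bar> < min d (M - v)"
    then show "u < M \<and> \<bar>1 / (M - v) - 1 / (M - u)\<bar> < \<epsilon>"
      using d(2)[of u] \<open>\<epsilon> > 0\<close> by (cases "u = v") (auto simp: dist_real_def abs_minus_commute)
  qed (use d assms in auto)
qed

lemma dX_less:
  assumes "f \<in> BV_homeos M" "g \<in> BV_homeos M"
    and "\<And>x. x \<in> Q \<Longrightarrow> norm (f x - g x) \<le> a"
    and "\<And>y. y \<in> Q \<Longrightarrow> norm (inv_into Q f y - inv_into Q g y) \<le> b"
    and "\<bar>1 / (M - real_of_ereal (Var f Q)) - 1 / (M - real_of_ereal (Var g Q))\<bar> < c"
  shows "dX M f g < a + b + c"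
proof -
  have "sup_norm_on Q (\<lambda>x. f x - g x) \<le> a" "sup_norm_on Q (\<lambda>y. inv_into Q f y - inv_into Q g y) \<le> b"
    unfolding sup_norm_on_def using assms(3,4) by (auto intro!: cSUP_least unit_square_nonempty)
  then show ?thesis using assms by (simp add: dX_def)
qed

text \<open>Only boundedly many \<open>k\<close> have \<open>|f(T\<^sub>k)|\<close> large. If \<open>f \<circ> h\<^sub>k\<close> had variation at least
  \<open>v + \<gamma>\<close> for all other \<open>k\<close>, then, the variation of every \<open>f \<circ> h\<^sub>k\<close> being almost at least \<open>v\<close> by
  lower semicontinuity, the average variation would exceed the bound above.\<close>

lemma good_index_exists:
  fixes p p' p'' :: "nat \<Rightarrow> real \<Rightarrow> real" and m :: "nat \<Rightarrow> real"
  assumes S: "\<And>k. k < N \<Longrightarrow> shear (p k) (p' k) (p'' k) \<tau> \<tau>' \<tau>''"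
    and f: "continuous_on Q f" "f ` Q \<subseteq> Q" "Var f Q = ereal v" and N: "N \<ge> 1"
    and pb: "\<And>k u. k < N \<Longrightarrow> 0 \<le> u \<Longrightarrow> u \<le> 1 \<Longrightarrow> \<bar>p k u\<bar> \<le> \<delta>" and \<delta>: "0 \<le> \<delta>"
    and C: "0 \<le> C" "\<And>v. 0 \<le> v \<Longrightarrow> v \<le> 1 \<Longrightarrow> \<bar>\<tau>' v\<bar> \<le> C"
    and sum: "\<And>u. (\<Sum>k<N. 1 + p' k u) \<le> real N + 2"
    and \<gamma>: "\<gamma> > 0" and \<phi>0: "\<phi>0 \<in> test_fields"
      "\<And>k. k < N \<Longrightarrow> v - \<gamma> / 2 \<le> var_integral (precompose f (shear.h (p k) \<tau>)) \<phi>0"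
    and m: "\<And>k. k < N \<Longrightarrow> 0 \<le> m k" "(\<Sum>k<N. m k) \<le> 3" "\<eta> > 0"
    and large: "3 / \<eta> * \<gamma> + 2 * v < real N * \<gamma> / 4" "C * \<delta> * v \<le> \<gamma> / 4"
  shows "\<exists>k<N. m k \<le> \<eta> \<and> Var (precompose f (shear.h (p k) \<tau>)) Q < ereal (v + \<gamma>)"
proof (rule ccontr)
  assume no: "\<not> ?thesis"
  let ?g = "\<lambda>k. precompose f (shear.h (p k) \<tau>)"
  define Bad where "Bad = {k. k < N \<and> \<eta> < m k}"
  have "\<exists>\<phi>\<in>test_fields. v + \<gamma> / 2 < var_integral (?g k) \<phi>" if "k < N" "k \<notin> Bad" for k
  proof -
    have "ereal (v + \<gamma> / 2) < ereal (v + \<gamma>)" using \<gamma> by simp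
    also have "\<dots> \<le> Var (?g k) Q" using no that by (auto simp: Bad_def not_less)
    finally show ?thesis unfolding Var_eq less_SUP_iff by simp
  qed
  then obtain \<psi> where \<psi>: "\<And>k. k < N \<Longrightarrow> k \<notin> Bad \<Longrightarrow> \<psi> k \<in> test_fields"
    "\<And>k. k < N \<Longrightarrow> k \<notin> Bad \<Longrightarrow> v + \<gamma> / 2 < var_integral (?g k) (\<psi> k)" by metis
  \<comment> \<open>A bad index may have a small variation, so it gets the field that is nearly
    optimal for f; every other index gets a field that witnesses its excess.\<close>
  define \<phi> where "\<phi> k = (if k \<in> Bad then \<phi>0 else \<psi> k)" for k
  have "(\<Sum>k<N. var_integral (?g k) (\<phi> k)) \<le> (real N + 2 + real N * (C * \<delta>)) * v"
    by (rule sum_var_integral_precompose_le[OF S f N pb \<delta> C sum])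
       (use \<psi>(1) \<phi>0(1) in \<open>auto simp: \<phi>_def\<close>)
  \<comment> \<open>A bad index replaces the surplus \<gamma>/2 by a deficit of at most \<gamma>/2,
    a loss of \<gamma>.\<close>
  moreover have "(\<Sum>k<N. v + \<gamma> / 2 - \<gamma> * of_bool (k \<in> Bad)) \<le> (\<Sum>k<N. var_integral (?g k) (\<phi> k))"
  proof (rule sum_mono)
    fix k assume "k \<in> {..<N}"
    then show "v + \<gamma> / 2 - \<gamma> * of_bool (k \<in> Bad) \<le> var_integral (?g k) (\<phi> k)"
      using \<phi>0(2)[of k] \<psi>(2)[of k] by (auto simp: \<phi>_def)
  qed
  moreover have "(\<Sum>k<N. v + \<gamma> / 2 - \<gamma> * of_bool (k \<in> Bad)) = real N * (v + \<gamma> / 2) - \<gamma> * real (card Bad)"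
  proof -
    have "{..<N} \<inter> Bad = Bad" by (auto simp: Bad_def)
    then show ?thesis by (simp add: sum_subtractf sum.distrib sum_distrib_left[symmetric] of_bool_def sum.If_cases)
  qed
  \<comment> \<open>Markov's inequality for the counting measure on the indices.\<close>
  moreover have "real (card Bad) \<le> 3 / \<eta>"
  proof -
    have "real (card Bad) * \<eta> = (\<Sum>k\<in>Bad. \<eta>)" by simp
    also have "\<dots> \<le> (\<Sum>k\<in>Bad. m k)" by (intro sum_mono) (auto simp: Bad_def)
    also have "\<dots> \<le> (\<Sum>k<N. m k)" by (intro sum_mono2) (auto simp: Bad_def m)
    finally show ?thesis using m by (simp add: field_simps)
  qed
  then have "\<gamma> * real (card Bad) \<le> 3 / \<eta> * \<gamma>" using \<gamma> by (metis mult.commute mult_left_mono less_imp_le)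
  moreover have "real N * (C * \<delta> * v) \<le> real N * (\<gamma> / 4)" using large(2) by (intro mult_left_mono) auto
  moreover have "(real N + 2 + real N * (C * \<delta>)) * v = real N * v + 2 * v + real N * (C * \<delta> * v)"
    "real N * (v + \<gamma> / 2) = real N * v + 2 * (real N * \<gamma> / 4)" "real N * (\<gamma> / 4) = real N * \<gamma> / 4"
    by (simp_all add: algebra_simps)
  ultimately show False using large(1) by linarith
qed

text \<open>The order of choices avoids circularity. The compact set \<open>K0\<close> determines
  the strip, and this the cutoff and its slope bound \<open>C\<close>; \<open>N\<close> depends only
  on \<delta>, \<gamma> and v. The amplitude \<open>d\<close> is then taken small against
  \<open>C\<close> and the modulus of continuity of f, and the number \<open>m0\<close> of cells
  realises it.\<close>

lemma concentrated_dense: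
  assumes fX: "f \<in> BV_homeos M" and "\<epsilon> > 0" "\<delta> > 0"
  shows "\<exists>g\<in>concentrated M \<delta>. dX M f g < \<epsilon>"
proof -
  note f = BV_homeosD[OF fX]
  obtain v where v: "Var f Q = ereal v" "0 \<le> v" "v < M" using BV_homeos_Var[OF fX] .
  obtain \<gamma> where \<gamma>: "\<gamma> > 0" "\<And>u. \<bar>u - v\<bar> < \<gamma> \<Longrightarrow> u < M \<and> \<bar>1 / (M - v) - 1 / (M - u)\<bar> < \<epsilon> / 4"
    using inverse_gap_continuous[OF v(3), of "\<epsilon> / 4"] \<open>\<epsilon> > 0\<close> by auto
  \<comment> \<open>A field nearly optimal for f gives up \<gamma>/4 here and at most \<gamma>/4
    more under the perturbation, whence the lower bound v - \<gamma>/2 for every perturbed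
    map.\<close>
  have "ereal (v - \<gamma> / 4) < Var f Q" using v \<gamma> by simp
  then obtain \<phi>0 where \<phi>0: "\<phi>0 \<in> test_fields" "v - \<gamma> / 4 < var_integral f \<phi>0"
    unfolding Var_eq less_SUP_iff by auto
  have \<phi>0C: "\<phi>0 \<in> C1_compact_support Q" using \<phi>0 by (simp add: test_fields_def)
  have fQ: "f ` Q \<subseteq> Q" using f(3) by simp
  obtain d0 where d0: "d0 > 0" "\<And>g. continuous_on Q g \<Longrightarrow> g ` Q \<subseteq> Q \<Longrightarrow>
    (\<And>x. x \<in> Q \<Longrightarrow> norm (g x - f x) \<le> d0) \<Longrightarrow> \<bar>var_integral g \<phi>0 - var_integral f \<phi>0\<bar> \<le> \<gamma> / 4"
    by (rule var_integral_continuous[OF f(2) fQ \<phi>0C, of "\<gamma> / 4"]) (use \<gamma>(1) in simp, blast)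
  obtain d1 where d1: "d1 > 0" "\<And>x y. x \<in> Q \<Longrightarrow> y \<in> Q \<Longrightarrow> norm (y - x) < d1 \<Longrightarrow> norm (f y - f x) < min d0 (\<epsilon> / 4)"
    using uniformly_continuous_BV_homeos[OF fX, of "min d0 (\<epsilon> / 4)"] d0(1) \<open>\<epsilon> > 0\<close> by auto
  obtain K0 where K0: "compact K0" "K0 \<subseteq> Q" "1 - \<delta> / 2 < measure lebesgue K0"
    using compact_subset_almost_full[of "\<delta> / 2"] \<open>\<delta> > 0\<close> by auto
  have "compact (inv_into Q f ` K0)"
    using f(4) K0 by (intro compact_continuous_image) (auto intro: continuous_on_subset)
  moreover have invK0: "inv_into Q f ` K0 \<subseteq> Q" using f(5) K0 by blast
  ultimately obtain \<beta> where \<beta>: "0 < \<beta>" "\<And>x. x \<in> inv_into Q f ` K0 \<Longrightarrow> \<beta> < x$2"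
    "\<And>x. x \<in> inv_into Q f ` K0 \<Longrightarrow> x$2 < 1 - \<beta>"
    using compact_in_Q_strip by blast
  obtain \<tau> \<tau>' \<tau>'' C where cut: "\<And>v. (\<tau> has_real_derivative \<tau>' v) (at v)" "\<And>v. (\<tau>' has_real_derivative \<tau>'' v) (at v)"
    "continuous_on UNIV \<tau>''" "\<tau> 0 = 0" "\<tau> 1 = 0" "\<And>v. 0 \<le> \<tau> v" "\<And>v. \<tau> v \<le> 1"
    "\<And>v. \<beta> \<le> v \<Longrightarrow> v \<le> 1 - \<beta> \<Longrightarrow> \<tau> v = 1" and C: "0 \<le> C" "\<And>v. 0 \<le> v \<Longrightarrow> v \<le> 1 \<Longrightarrow> \<bar>\<tau>' v\<bar> \<le> C"
    using cutoff_exists[OF \<beta>(1)] by metis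
  \<comment> \<open>The set \<open>P\<close> below has determinant up to 2 \<eta>, which is at most
    \<delta>/2; the bound 1/2 keeps \<eta> below 1.\<close>
  define \<eta> where "\<eta> = min (\<delta> / 4) (1 / 2)"
  have \<eta>: "0 < \<eta>" "\<eta> < 1" "\<eta> \<le> \<delta> / 4" using \<open>\<delta> > 0\<close> by (auto simp: \<eta>_def)
  \<comment> \<open>The total surplus is N \<gamma>/2. The cutoff may consume half of it, and the
    remaining N \<gamma>/4 has to outweigh the loss from at most 12/\<delta> bad indices together
    with the excess 2 v in the averaged bound.\<close>
  obtain N0 :: nat where N0: "(3 / (\<delta> / 4) * \<gamma> + 2 * v) * 4 / \<gamma> < real N0" using reals_Archimedean2 by blast
  define N where "N = Suc N0"
  have N: "N \<ge> 1" "3 / (\<delta> / 4) * \<gamma> + 2 * v < real N * \<gamma> / 4"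
    using N0 \<gamma>(1) by (auto simp: N_def field_simps)
  \<comment> \<open>The three entries make f o h uniformly close to f, make the inverses close, and
    keep the cutoff cost C d v below \<gamma>/4.\<close>
  define d where "d = Min {d1 / 2, \<epsilon> / 4, \<gamma> / (4 * (C * v + 1))}"
  have Cv: "0 < C * v + 1" using C v by (simp add: add_nonneg_pos)
  have d: "0 < d" "d < d1" "d \<le> \<epsilon> / 4" "d \<le> \<gamma> / (4 * (C * v + 1))"
  proof -
    show "0 < d" using d1(1) \<open>\<epsilon> > 0\<close> \<gamma>(1) Cv by (simp add: d_def)
    have "d \<le> d1 / 2" unfolding d_def by (intro Min_le) simp_all
    then show "d < d1" using d1(1) by linarith
  qed (unfold d_def, intro Min_le, simp_all)
  obtain m0 :: nat where m0: "1 / d < real m0" using reals_Archimedean2 by blast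
  have m0_pos: "0 < real m0" using m0 d(1) by (meson less_trans zero_less_divide_1_iff)
  then have m: "m0 \<ge> 1" "1 / real m0 \<le> d" using m0 d(1) by (auto simp: field_simps)
  obtain p p' p'' :: "nat \<Rightarrow> real \<Rightarrow> real" and T :: "nat \<Rightarrow> real set"
    where fam: "\<And>k u. (p k has_real_derivative p' k u) (at u)"
    "\<And>k u. (p' k has_real_derivative p'' k u) (at u)"
    "\<And>k. continuous_on UNIV (p'' k)"
    "\<And>k. p k 0 = 0" "\<And>k. k < N \<Longrightarrow> p k 1 = 0"
    "\<And>k u. k < N \<Longrightarrow> 0 \<le> u \<Longrightarrow> u \<le> 1 \<Longrightarrow> \<bar>p k u\<bar> \<le> 1 / real m0"
    "\<And>k u. \<eta> - 1 \<le> p' k u"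
    "\<And>k. open (T k)" "\<And>k u. u \<notin> T k \<Longrightarrow> p' k u = \<eta> - 1"
    "\<And>u. card {k. k < N \<and> u \<in> T k} \<le> 3"
    "\<And>u. (\<Sum>k<N. 1 + p' k u) \<le> real N + 2"
    by (rule perturbation_family[OF m(1) N(1) \<eta>(1,2)]) blast
  have p_le: "\<bar>p k u\<bar> \<le> d" if "k < N" "0 \<le> u" "u \<le> 1" for k u using fam(6)[OF that] m by linarith
  have p'_gt: "-1 < p' k u" for k u using fam(7)[of k u] \<eta> by linarith
  have S: "shear (p k) (p' k) (p'' k) \<tau> \<tau>' \<tau>''" if "k < N" for k
    by unfold_locales (use fam(1-3) fam(4)[of k] fam(5)[OF that] p'_gt cut in auto)
  let ?h = "\<lambda>k. shear.h (p k) \<tau>" and ?H = "\<lambda>k. shear.H (p k) \<tau>"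
  let ?g = "\<lambda>k. precompose f (?h k)"
  have gf: "norm (?g k x - f x) < min d0 (\<epsilon> / 4)" if "k < N" "x \<in> Q" for k x
  proof -
    have "norm (?h k x - x) \<le> d"
      using shear.norm_h_diff_le[OF S p_le] that Q_subset_Qc by blast
    then show ?thesis
      using d1(2)[OF that(2) shear.h_in_Q[OF S[OF that(1)] that(2)]] d(2) that(2)
      by (simp add: precompose_def)
  qed
  define TQ where "TQ k = {w\<in>Q. w$1 \<in> T k}" for k
  have TQ: "open (TQ k)" "TQ k \<subseteq> Q" for k
  proof -
    have "TQ k = Q \<inter> (\<lambda>w. w$1) -` T k" by (auto simp: TQ_def)
    moreover have "open ((\<lambda>w::real^2. w$1) -` T k)" by (intro open_vimage fam(8) continuous_intros)
    ultimately show "open (TQ k)" using open_Q by auto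
  qed (auto simp: TQ_def)
  have fT: "open (f ` TQ k)" "f ` TQ k \<subseteq> Q" for k
    using homeomorphism_open_image_Q[OF f(1) TQ] TQ(2)[of k] fQ by blast+
  have overlap: "(\<Sum>k<N. measure lebesgue (f ` TQ k)) \<le> real 3 * measure lebesgue Q"
  proof (rule sum_measure_le_overlap)
    fix y assume y: "y \<in> Q"
    \<comment> \<open>Since f is injective, y lies in the image of the strip over T k only if the
      first coordinate of its preimage lies in T k.\<close>
    have "{k \<in> {..<N}. y \<in> f ` TQ k} \<subseteq> {k. k < N \<and> inv_into Q f y $ 1 \<in> T k}"
      using f(7) by (auto simp: TQ_def)
    then have "card {k \<in> {..<N}. y \<in> f ` TQ k} \<le> card {k. k < N \<and> inv_into Q f y $ 1 \<in> T k}"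
      by (intro card_mono) auto
    then show "card {k \<in> {..<N}. y \<in> f ` TQ k} \<le> 3" using fam(10)[of "inv_into Q f y $ 1"] by linarith
  qed (use fT measurable_Q in \<open>auto simp: content_Q\<close>)
  have lsc: "v - \<gamma> / 2 \<le> var_integral (?g k) \<phi>0" if k: "k < N" for k
  proof -
    have "\<bar>var_integral (?g k) \<phi>0 - var_integral f \<phi>0\<bar> \<le> \<gamma> / 4"
      using gf[OF k] by (intro d0(2) shear.continuous_precompose[OF S[OF k] f(2) fQ]) (simp add: less_imp_le)
    then show ?thesis using \<phi>0(2) by linarith
  qed
  have "C * d * v \<le> \<gamma> / 4"
  proof -
    have cancel: "x * (\<gamma> / (4 * x)) = \<gamma> / 4" if "0 < x" for x :: real using that by simp
    have "C * d * v \<le> (C * v + 1) * d" using d(1) by (simp add: algebra_simps)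
    also have "\<dots> \<le> (C * v + 1) * (\<gamma> / (4 * (C * v + 1)))" using d(4) Cv by (intro mult_left_mono) auto
    also have "\<dots> = \<gamma> / 4" by (rule cancel[OF Cv])
    finally show ?thesis .
  qed
  then have "\<exists>k<N. measure lebesgue (f ` TQ k) \<le> \<delta> / 4 \<and> Var (?g k) Q < ereal (v + \<gamma>)"
    using overlap \<open>\<delta> > 0\<close> d(1)
    by (intro good_index_exists[OF S f(2) fQ v(1) N(1) p_le _ C fam(11) \<gamma>(1) \<phi>0(1) lsc _ _ _ N(2)])
       (auto simp: content_Q)
  then obtain k where k: "k < N" "measure lebesgue (f ` TQ k) \<le> \<delta> / 4" "Var (?g k) Q < ereal (v + \<gamma>)" by blast
  interpret shear "p k" "p' k" "p'' k" \<tau> \<tau>' \<tau>'' by (rule S[OF k(1)])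
  note ginv = homeomorphism_precompose[OF f(1)]
  obtain u where u: "Var (?g k) Q = ereal u" "\<bar>u - v\<bar> < \<gamma>"
  proof -
    have lo: "ereal (v - \<gamma> / 2) \<le> Var (?g k) Q"
      using Var_ge_var_integral[OF \<phi>0(1), of "?g k"] lsc[OF k(1)] by (meson ereal_less_eq(3) order_trans)
    then obtain u where "Var (?g k) Q = ereal u" using k(3) by (cases "Var (?g k) Q") auto
    then show ?thesis using lo k(3) \<gamma>(1) by (intro that[of u]) auto
  qed
  have gX: "?g k \<in> BV_homeos M"
    using ginv(1) identity_on_boundary_precompose[OF f(6)] u \<gamma>(2)[OF u(2)]
    by (simp add: BV_homeos_def BV_def precompose_def)
  have "dX M f (?g k) < \<epsilon> / 4 + \<epsilon> / 4 + \<epsilon> / 4"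
  proof (rule dX_less[OF fX gX])
    show "norm (f x - ?g k x) \<le> \<epsilon> / 4" if "x \<in> Q" for x
      using gf[OF k(1) that] by (simp add: norm_minus_commute)
    show "norm (inv_into Q f y - inv_into Q (?g k) y) \<le> \<epsilon> / 4" if "y \<in> Q" for y
    proof -
      have "inv_into Q f y \<in> Qc" using f(5) that Q_subset_Qc by blast
      then have "norm (H (inv_into Q f y) - inv_into Q f y) \<le> d"
        using p_le[OF k(1)] by (intro norm_H_diff_le)
      then show ?thesis using d(3) by (simp add: ginv(2)[OF that] norm_minus_commute)
    qed
    show "\<bar>1 / (M - real_of_ereal (Var f Q)) - 1 / (M - real_of_ereal (Var (?g k) Q))\<bar> < \<epsilon> / 4"
      using \<gamma>(2)[OF u(2)] by (simp add: u v)
  qed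
  moreover have "?g k \<in> concentrated M \<delta>"
  proof -
    \<comment> \<open>The strict inequality with 2 \<eta> replaces the equality p' = \<eta> - 1 in
      order to make the set open; in the strip the cutoff is 1, so the determinant is 1 + p' and
      stays below 2 \<eta>.\<close>
    define P where "P = {w\<in>Q. \<beta> < w$2 \<and> w$2 < 1 - \<beta> \<and> p' k (w$1) < 2 * \<eta> - 1}"
    have PQ: "P \<subseteq> Q" by (auto simp: P_def)
    have P: "open P"
    proof -
      have "P = Q \<inter> {w. \<beta> < w$2 \<and> w$2 < 1 - \<beta> \<and> p' k (w$1) < 2 * \<eta> - 1}" by (auto simp: P_def)
      moreover have "continuous_on UNIV (\<lambda>w::real^2. p' k (w$1))"
        by (rule continuous_on_compose2[of UNIV "p' k"])
           (auto intro!: continuous_intros DERIV_continuous_on fam(2))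
      then have "open {w::real^2. \<beta> < w$2 \<and> w$2 < 1 - \<beta> \<and> p' k (w$1) < 2 * \<eta> - 1}"
        by (intro open_Collect_conj open_Collect_less continuous_intros)
      ultimately show ?thesis using open_Q by auto
    qed
    have V: "open (H ` P)" "H ` P \<subseteq> Q"
      using homeomorphism_open_image_Q[OF homeomorphism_H P PQ] PQ H_in_Q by auto
    have PL: "P \<in> lmeasurable"
      using P bounded_subset[OF bounded_unit_square PQ] by (intro lmeasurable_open)
    have detP: "\<bar>det (matrix (DH w))\<bar> \<le> 2 * \<eta>" if "w \<in> P" for w
      using that cut(8)[of "w$2"] p'_gt[of k "w$1"] by (simp add: det_DH P_def)
    have cdet: "(\<lambda>w. \<bar>det (matrix (DH w))\<bar>) integrable_on P"
    proof (rule measurable_bounded_by_integrable_imp_integrable[where g = "\<lambda>w. 2 * \<eta>"])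
      show "(\<lambda>w. \<bar>det (matrix (DH w))\<bar>) \<in> borel_measurable (lebesgue_on P)"
      proof (rule continuous_imp_measurable_on_sets_lebesgue)
        have "continuous_on P (\<lambda>w. \<tau> (w$2))" "continuous_on P (\<lambda>w. p' k (w$1))"
          by (rule continuous_on_compose2[of UNIV];
              auto intro!: continuous_intros DERIV_continuous_on cut(1) fam(2))+
        then show "continuous_on P (\<lambda>w. \<bar>det (matrix (DH w))\<bar>)"
          unfolding det_DH by (intro continuous_intros)
        show "P \<in> sets lebesgue" using PL by blast
      qed
    qed (use PL detP in \<open>auto intro: integrable_on_const\<close>)
    have "measure lebesgue (H ` P) \<le> 2 * \<eta> * measure lebesgue P"
      by (rule measure_bounded_differentiable_image[OF PL _ cdet detP])
         (auto intro: has_derivative_at_withinI has_derivative_H)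
    also have "\<dots> \<le> 2 * \<eta> * 1"
    proof (rule mult_left_mono)
      have "measure lebesgue P \<le> measure lebesgue Q"
        using PQ PL by (intro measure_mono_fmeasurable) (auto simp: unit_square_def)
      then show "measure lebesgue P \<le> 1" by (simp add: content_Q)
    qed (use \<eta> in simp)
    also have "\<dots> < \<delta>" using \<eta> \<open>\<delta> > 0\<close> by simp
    finally have mV: "measure lebesgue (H ` P) < \<delta>" .
    \<comment> \<open>Removing an open set keeps \<open>K\<close> compact and costs at most
      \<delta>/4 of measure, on top of the \<delta>/2 already missing from
      \<open>K0\<close>.\<close>
    define K where "K = K0 - f ` TQ k"
    have K: "compact K" "K \<subseteq> Q" unfolding K_def using K0 fT by (auto intro: compact_diff)
    have "inv_into Q (?g k) y \<in> H ` P" if y: "y \<in> K" for y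
    proof -
      let ?w = "inv_into Q f y"
      have w: "?w \<in> Q" "f ?w = y" using y K f(5,8) by auto
      have "?w \<in> inv_into Q f ` K0" using y by (simp add: K_def)
      moreover have "?w $ 1 \<notin> T k" using y w by (force simp: K_def TQ_def)
      ultimately have "?w \<in> P" using w(1) \<beta> fam(9)[of "?w $ 1" k] \<eta> by (simp add: P_def)
      then show ?thesis using ginv(2) y K by auto
    qed
    moreover have "1 - \<delta> < measure lebesgue K"
    proof -
      have L: "K0 \<in> lmeasurable" "f ` TQ k \<in> lmeasurable"
        using K0 fT bounded_subset[OF bounded_unit_square] by (auto intro: lmeasurable_compact lmeasurable_open)
      have "measure lebesgue K0 \<le> measure lebesgue (K \<union> f ` TQ k)"
        using L by (intro measure_mono_fmeasurable) (auto simp: K_def)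
      also have "\<dots> \<le> measure lebesgue K + measure lebesgue (f ` TQ k)"
        using L by (intro measure_Un_le) (auto simp: K_def)
      finally show ?thesis using K0(3) k(2) \<open>\<delta> > 0\<close> by linarith
    qed
    ultimately show ?thesis
      unfolding concentrated_def using gX V K mV by blast
  qed
  ultimately show ?thesis using \<open>\<epsilon> > 0\<close> by (intro bexI[of _ "?g k"]) auto
qed

theorem theorem1p2:
  fixes M :: real
  assumes "M > 2"
  shows "residual_in (Metric_space.mtopology (BV_homeos M) (dX M)) (null_to_full M)"
  by (rule residual_if_dense) (rule concentrated_dense)

end
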